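(* Let $\Omega$ be an infinite set. Then there exists a $0,1$-lattice embedding (a one-to-one lattice homomorphism preserving least and greatest elements) from $(\operatorname{Eq}\Omega)\amalg^0(\operatorname{Eq}\Omega)$ into $\operatorname{Eq}\Omega$.
   Context: $\operatorname{Eq}\Omega$ denotes the lattice of all equivalence relations on the set $\Omega$, ordered by inclusion. For lattices with zero $L_1,L_2$, $L_1\amalg^0 L_2$ denotes their $0$-coproduct, i.e. their coproduct (free product) in the category of lattices with zero and zero-preserving lattice homomorphisms. *)

theory Defs
  imports Main
begin

definition EqL :: "'a set \<Rightarrow> 'a rel set" where
  "EqL \<Omega> = {r. equiv \<Omega> r}"

definition eq_join :: "'a rel \<Rightarrow> 'a rel \<Rightarrow> 'a rel" where
  "eq_join r s = (r \<union> s)\<^sup>+"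

definition eq_meet :: "'a rel \<Rightarrow> 'a rel \<Rightarrow> 'a rel" where
  "eq_meet r s = r \<inter> s"

datatype 'g lterm = Gen 'g | Join "'g lterm" "'g lterm" | Meet "'g lterm" "'g lterm"

fun wf_term :: "'a set \<Rightarrow> ('a rel + 'a rel) lterm \<Rightarrow> bool" where
  "wf_term \<Omega> (Gen (Inl a)) = (a \<in> EqL \<Omega>)"
| "wf_term \<Omega> (Gen (Inr a)) = (a \<in> EqL \<Omega>)"
| "wf_term \<Omega> (Join s t) = (wf_term \<Omega> s \<and> wf_term \<Omega> t)"
| "wf_term \<Omega> (Meet s t) = (wf_term \<Omega> s \<and> wf_term \<Omega> t)"

text \<open>The 0-coproduct 0-coproduct of Eq(Omega) with itself, presented as the quotient of the term
  algebra by the least lattice congruence making both generator inclusions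
  lattice homomorphisms and identifying the two zeros.\<close>

inductive coprod0_eq :: "'a set \<Rightarrow> ('a rel + 'a rel) lterm \<Rightarrow> ('a rel + 'a rel) lterm \<Rightarrow> bool"
  for \<Omega> :: "'a set" where
  refl: "coprod0_eq \<Omega> t t"
| sym: "coprod0_eq \<Omega> s t \<Longrightarrow> coprod0_eq \<Omega> t s"
| trans: "coprod0_eq \<Omega> s t \<Longrightarrow> coprod0_eq \<Omega> t u \<Longrightarrow> coprod0_eq \<Omega> s u"
| cong_join: "coprod0_eq \<Omega> s s' \<Longrightarrow> coprod0_eq \<Omega> t t' \<Longrightarrow> coprod0_eq \<Omega> (Join s t) (Join s' t')"
| cong_meet: "coprod0_eq \<Omega> s s' \<Longrightarrow> coprod0_eq \<Omega> t t' \<Longrightarrow> coprod0_eq \<Omega> (Meet s t) (Meet s' t')"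
| join_assoc: "coprod0_eq \<Omega> (Join (Join s t) u) (Join s (Join t u))"
| meet_assoc: "coprod0_eq \<Omega> (Meet (Meet s t) u) (Meet s (Meet t u))"
| join_comm: "coprod0_eq \<Omega> (Join s t) (Join t s)"
| meet_comm: "coprod0_eq \<Omega> (Meet s t) (Meet t s)"
| join_idem: "coprod0_eq \<Omega> (Join s s) s"
| meet_idem: "coprod0_eq \<Omega> (Meet s s) s"
| absorb1: "coprod0_eq \<Omega> (Join s (Meet s t)) s"
| absorb2: "coprod0_eq \<Omega> (Meet s (Join s t)) s"
| inl_join: "a \<in> EqL \<Omega> \<Longrightarrow> b \<in> EqL \<Omega> \<Longrightarrow>
    coprod0_eq \<Omega> (Gen (Inl (eq_join a b))) (Join (Gen (Inl a)) (Gen (Inl b)))"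
| inl_meet: "a \<in> EqL \<Omega> \<Longrightarrow> b \<in> EqL \<Omega> \<Longrightarrow>
    coprod0_eq \<Omega> (Gen (Inl (eq_meet a b))) (Meet (Gen (Inl a)) (Gen (Inl b)))"
| inr_join: "a \<in> EqL \<Omega> \<Longrightarrow> b \<in> EqL \<Omega> \<Longrightarrow>
    coprod0_eq \<Omega> (Gen (Inr (eq_join a b))) (Join (Gen (Inr a)) (Gen (Inr b)))"
| inr_meet: "a \<in> EqL \<Omega> \<Longrightarrow> b \<in> EqL \<Omega> \<Longrightarrow>
    coprod0_eq \<Omega> (Gen (Inr (eq_meet a b))) (Meet (Gen (Inr a)) (Gen (Inr b)))"
| zeros: "coprod0_eq \<Omega> (Gen (Inl (Id_on \<Omega>))) (Gen (Inr (Id_on \<Omega>)))"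

definition coprod0_zero :: "'a set \<Rightarrow> ('a rel + 'a rel) lterm" where
  "coprod0_zero \<Omega> = Gen (Inl (Id_on \<Omega>))"

definition coprod0_top :: "'a set \<Rightarrow> ('a rel + 'a rel) lterm" where
  "coprod0_top \<Omega> = Join (Gen (Inl (\<Omega> \<times> \<Omega>))) (Gen (Inr (\<Omega> \<times> \<Omega>)))"

text \<open>A 0,1-lattice embedding of the coproduct into Eq(Omega), given on representatives:
  well defined on classes, lattice homomorphism, preserves 0 and 1, injective on classes.\<close>

definition coprod0_embedding :: "'a set \<Rightarrow> (('a rel + 'a rel) lterm \<Rightarrow> 'a rel) \<Rightarrow> bool" where
  "coprod0_embedding \<Omega> F \<longleftrightarrow>
     (\<forall>t. wf_term \<Omega> t \<longrightarrow> F t \<in> EqL \<Omega>) \<and>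
     (\<forall>s t. wf_term \<Omega> s \<longrightarrow> wf_term \<Omega> t \<longrightarrow> coprod0_eq \<Omega> s t \<longrightarrow> F s = F t) \<and>
     (\<forall>s t. wf_term \<Omega> s \<longrightarrow> wf_term \<Omega> t \<longrightarrow> F (Join s t) = eq_join (F s) (F t)) \<and>
     (\<forall>s t. wf_term \<Omega> s \<longrightarrow> wf_term \<Omega> t \<longrightarrow> F (Meet s t) = eq_meet (F s) (F t)) \<and>
     F (coprod0_zero \<Omega>) = Id_on \<Omega> \<and>
     F (coprod0_top \<Omega>) = \<Omega> \<times> \<Omega> \<and>
     (\<forall>s t. wf_term \<Omega> s \<longrightarrow> wf_term \<Omega> t \<longrightarrow> F s = F t \<longrightarrow> coprod0_eq \<Omega> s t)"

end

theory Submission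
  imports Defs "HOL-Library.Equipollence"
begin

text \<open>
  Write \<open>P\<close> for the coproduct and call a term finite if all its generators are relations that are
  trivial off a finite set.

  Restricting all generators of a term to a finite set approximates it from below. Finite terms are
  compact in \<open>P\<close>, and every element of \<open>P\<close> is determined by the finite terms below it. For the
  latter one needs Whitman's condition modulo the generators, which holds because doubling a convex
  set without generators yields a lattice to which both homomorphisms lift, and the fact that the least
  generator above a term depends continuously on the term.

  There are only \<open>|\<Omega>|\<close> finite terms. They serve as colours of the edges of a graph, in which
  the ends of every edge of a colour \<open>c \<le> a \<squnion> b\<close> are also joined by a path of four edges with
  colours \<open>a, b, a, b\<close>. An element \<open>t\<close> of \<open>P\<close> is sent to the relation of
  being connected by edges with colours below \<open>t\<close>.
\<close>

text \<open>The coproduct has more elements than \<Omega>, so a graph with one colour per element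
  would not fit on \<Omega>. Using compact elements only has two prices: compactness must supply
  colours \<open>a\<close>, \<open>b\<close> for the paths that realise joins, and density must let
  the colours separate elements.

  Density is delicate for a meet below a join, where neither side can be taken apart. Whitman's
  condition leaves four smaller inequalities or a generator in between. Finite sets refuting these
  alternatives can be united, once the generator, which might vary with the finite set, is replaced
  by the largest one below the right-hand side.

  The length four is forced by intersections. Let \<open>S\<close> contain \<open>a\<close> but not
  \<open>b\<close>, and \<open>T\<close> contain \<open>b\<close> but not \<open>a\<close>. On a
  path \<open>a, b\<close>, the middle vertex is tied to the source by \<open>S\<close> and to the
  target by \<open>T\<close>, hence to the source by both if \<open>T\<close> ties the ends of the
  edge. On \<open>a, b, a\<close>, the two inner vertices are tied by \<open>T\<close>, and by
  \<open>S\<close> if it ties the ends. On \<open>a, b, a, b\<close>, no inner vertex is tied to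
  another vertex of the path by both, even if both tie the ends.\<close>

lemma EqL_I:
  assumes "r \<subseteq> \<Omega> \<times> \<Omega>" "Id_on \<Omega> \<subseteq> r" "\<And>x y. (x, y) \<in> r \<Longrightarrow> (y, x) \<in> r"
    "\<And>x y z. (x, y) \<in> r \<Longrightarrow> (y, z) \<in> r \<Longrightarrow> (x, z) \<in> r"
  shows "r \<in> EqL \<Omega>"
  unfolding EqL_def mem_Collect_eq
proof (rule equivI)
  show "refl_on \<Omega> r"
    using assms(2) by (auto intro: refl_onI)
  show "sym r"
    using assms(3) by (rule symI)
  show "trans r"
    using assms(4) by (rule transI)
qed (rule assms(1))

lemma EqL_D:
  assumes "r \<in> EqL \<Omega>"
  shows "r \<subseteq> \<Omega> \<times> \<Omega>" "Id_on \<Omega> \<subseteq> r" "(x, y) \<in> r \<Longrightarrow> (y, x) \<in> r"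
    "(x, y) \<in> r \<Longrightarrow> (y, z) \<in> r \<Longrightarrow> (x, z) \<in> r"
proof -
  have *: "r \<subseteq> \<Omega> \<times> \<Omega>" "refl_on \<Omega> r" "sym r" "trans r"
    using assms by (simp_all add: EqL_def equiv_def)
  show "r \<subseteq> \<Omega> \<times> \<Omega>"
    by (rule *)
  show "Id_on \<Omega> \<subseteq> r"
    using *(2) by (auto dest: refl_onD)
  show "(x, y) \<in> r \<Longrightarrow> (y, x) \<in> r"
    using *(3) by (rule symD)
  show "(x, y) \<in> r \<Longrightarrow> (y, z) \<in> r \<Longrightarrow> (x, z) \<in> r"
    using *(4) by (rule transD)
qed

lemma Id_on_EqL [simp]: "Id_on \<Omega> \<in> EqL \<Omega>"
  by (rule EqL_I) auto

lemma Times_EqL [simp]: "\<Omega> \<times> \<Omega> \<in> EqL \<Omega>"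
  by (rule EqL_I) auto

lemma Int_EqL [simp]:
  assumes a: "a \<in> EqL \<Omega>" and b: "b \<in> EqL \<Omega>"
  shows "a \<inter> b \<in> EqL \<Omega>"
proof (rule EqL_I)
  show "a \<inter> b \<subseteq> \<Omega> \<times> \<Omega>" "Id_on \<Omega> \<subseteq> a \<inter> b"
    using EqL_D(1,2)[OF a] EqL_D(2)[OF b] by blast+
  show "(y, x) \<in> a \<inter> b" if "(x, y) \<in> a \<inter> b" for x y
    using that EqL_D(3)[OF a] EqL_D(3)[OF b] by simp
  show "(x, z) \<in> a \<inter> b" if "(x, y) \<in> a \<inter> b" "(y, z) \<in> a \<inter> b" for x y z
    using that EqL_D(4)[OF a, of x y z] EqL_D(4)[OF b, of x y z] by simp
qed

lemma eq_join_upper: "a \<subseteq> eq_join a b" "b \<subseteq> eq_join a b"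
  unfolding eq_join_def by auto

lemma eq_join_least:
  assumes "c \<in> EqL \<Omega>" "a \<subseteq> c" "b \<subseteq> c"
  shows "eq_join a b \<subseteq> c"
proof -
  have "trans c"
    using EqL_D(4)[OF assms(1)] by (rule transI)
  then have "c\<^sup>+ = c"
    by (rule trancl_id)
  then show ?thesis
    unfolding eq_join_def using assms(2,3) trancl_mono_subset[of "a \<union> b" c] by simp
qed

lemma eq_join_EqL [simp]:
  assumes a: "a \<in> EqL \<Omega>" and b: "b \<in> EqL \<Omega>"
  shows "eq_join a b \<in> EqL \<Omega>"
proof (rule EqL_I)
  show "eq_join a b \<subseteq> \<Omega> \<times> \<Omega>"
    using EqL_D(1)[OF a] EqL_D(1)[OF b] by (rule eq_join_least[OF Times_EqL])
  show "Id_on \<Omega> \<subseteq> eq_join a b"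
    using EqL_D(2)[OF a] eq_join_upper(1) by (rule subset_trans)
  have "sym (a \<union> b)"
    using EqL_D(3)[OF a] EqL_D(3)[OF b] by (auto intro: symI)
  then show "(y, x) \<in> eq_join a b" if "(x, y) \<in> eq_join a b" for x y
    using that sym_trancl unfolding eq_join_def by (metis symD)
  show "(x, z) \<in> eq_join a b" if "(x, y) \<in> eq_join a b" "(y, z) \<in> eq_join a b" for x y z
    using that unfolding eq_join_def by (rule trancl_trans)
qed

lemma eq_join_absorb: "b \<in> EqL \<Omega> \<Longrightarrow> a \<subseteq> b \<Longrightarrow> eq_join a b = b"
  by (simp add: eq_join_least eq_join_upper subset_antisym)

lemma eq_join_commute: "eq_join a b = eq_join b a"
  by (simp add: eq_join_def Un_commute)

subsection \<open>The order of the coproduct\<close>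

fun side :: "'b + 'b \<Rightarrow> bool" where
  "side (Inl a) = True"
| "side (Inr a) = False"

fun val :: "'b + 'b \<Rightarrow> 'b" where
  "val (Inl a) = a"
| "val (Inr a) = a"

definition gen :: "bool \<Rightarrow> 'b \<Rightarrow> ('b + 'b) lterm" where
  "gen i a = Gen (if i then Inl a else Inr a)"

lemma side_val_if [simp]: "side (if i then Inl a else Inr a) = i" "val (if i then Inl a else Inr a) = a"
  by auto

lemma Gen_eq: "Gen g = gen (side g) (val g)"
  by (cases g) (simp_all add: gen_def)

lemma term_cases_gen [case_names gen Join Meet, induct type: lterm]:
  assumes "\<And>i a. P (gen i a)"
    and "\<And>s t. P s \<Longrightarrow> P t \<Longrightarrow> P (Join s t)"
    and "\<And>s t. P s \<Longrightarrow> P t \<Longrightarrow> P (Meet s t)"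
  shows "P t"
  by (rule lterm.induct) (use assms in \<open>auto simp: Gen_eq\<close>)

text \<open>Terms need not be well formed: a generator that is not an equivalence relation is read as zero.\<close>

definition nrm :: "'a set \<Rightarrow> 'a rel \<Rightarrow> 'a rel" where
  "nrm \<Omega> a = (if a \<in> EqL \<Omega> then a else Id_on \<Omega>)"

lemma nrm_EqL [simp]: "nrm \<Omega> a \<in> EqL \<Omega>"
  by (simp add: nrm_def)

lemma nrm_id [simp]: "a \<in> EqL \<Omega> \<Longrightarrow> nrm \<Omega> a = a"
  by (simp add: nrm_def)

type_synonym 'a eqterm = "('a rel + 'a rel) lterm"

text \<open>The universal property in a form that needs no target lattice: \<open>le\<close> below
  is the least such preorder (\<open>le_imp\<close>). A monotonicity statement about a recursion on
  terms is proved by exhibiting an instance \<open>Q\<close>.\<close>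

locale coprod_preorder =
  fixes \<Omega> :: "'a set" and Q :: "'a eqterm \<Rightarrow> 'a eqterm \<Rightarrow> bool"
  assumes reflexive [simp]: "Q s s"
    and transitive: "Q s t \<Longrightarrow> Q t u \<Longrightarrow> Q s u"
    and join1 [simp]: "Q s (Join s t)"
    and join2 [simp]: "Q t (Join s t)"
    and join_least: "Q s u \<Longrightarrow> Q t u \<Longrightarrow> Q (Join s t) u"
    and meet1 [simp]: "Q (Meet s t) s"
    and meet2 [simp]: "Q (Meet s t) t"
    and meet_greatest: "Q u s \<Longrightarrow> Q u t \<Longrightarrow> Q u (Meet s t)"
    and gen_mono: "nrm \<Omega> a \<subseteq> nrm \<Omega> b \<Longrightarrow> Q (gen i a) (gen i b)"
    and gen_join: "a \<in> EqL \<Omega> \<Longrightarrow> b \<in> EqL \<Omega> \<Longrightarrow> Q (gen i (eq_join a b)) (Join (gen i a) (gen i b))"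
    and gen_meet: "a \<in> EqL \<Omega> \<Longrightarrow> b \<in> EqL \<Omega> \<Longrightarrow> Q (Meet (gen i a) (gen i b)) (gen i (a \<inter> b))"
    and gen_zero: "Q (gen i (Id_on \<Omega>)) (gen j (Id_on \<Omega>))"
begin

lemma join_mono: "Q s s' \<Longrightarrow> Q t t' \<Longrightarrow> Q (Join s t) (Join s' t')"
  by (meson join1 join2 join_least transitive)

lemma meet_mono: "Q s s' \<Longrightarrow> Q t t' \<Longrightarrow> Q (Meet s t) (Meet s' t')"
  by (meson meet1 meet2 meet_greatest transitive)

lemma sound: "coprod0_eq \<Omega> s t \<Longrightarrow> Q s t \<and> Q t s"
proof (induction rule: coprod0_eq.induct)
  case (trans s t u)
  then show ?case using transitive by blast
next
  case (cong_join s s' t t')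
  then show ?case by (simp add: join_mono)
next
  case (cong_meet s s' t t')
  then show ?case by (simp add: meet_mono)
next
  case (join_assoc s t u)
  then show ?case by (meson join1 join2 join_least transitive)
next
  case (meet_assoc s t u)
  then show ?case by (meson meet1 meet2 meet_greatest transitive)
next
  case (inl_join a b)
  then show ?case
    using gen_join[of a b True] gen_mono[of a "eq_join a b" True] gen_mono[of b "eq_join a b" True]
    by (simp add: gen_def join_least eq_join_upper)
next
  case (inr_join a b)
  then show ?case
    using gen_join[of a b False] gen_mono[of a "eq_join a b" False] gen_mono[of b "eq_join a b" False]
    by (simp add: gen_def join_least eq_join_upper)
next
  case (inl_meet a b)
  then show ?case
    using gen_meet[of a b True] gen_mono[of "a \<inter> b" a True] gen_mono[of "a \<inter> b" b True]
    by (simp add: gen_def meet_greatest eq_meet_def)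
next
  case (inr_meet a b)
  then show ?case
    using gen_meet[of a b False] gen_mono[of "a \<inter> b" a False] gen_mono[of "a \<inter> b" b False]
    by (simp add: gen_def meet_greatest eq_meet_def)
next
  case zeros
  then show ?case
    using gen_zero[of True False] gen_zero[of False True] by (simp add: gen_def)
qed (simp_all add: join_least meet_greatest)

end

fun normalize :: "'a set \<Rightarrow> 'a eqterm \<Rightarrow> 'a eqterm" where
  "normalize \<Omega> (Gen g) = gen (side g) (nrm \<Omega> (val g))"
| "normalize \<Omega> (Join s t) = Join (normalize \<Omega> s) (normalize \<Omega> t)"
| "normalize \<Omega> (Meet s t) = Meet (normalize \<Omega> s) (normalize \<Omega> t)"

lemma normalize_gen [simp]: "normalize \<Omega> (gen i a) = gen i (nrm \<Omega> a)"
  by (simp add: gen_def)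

lemma normalize_id: "wf_term \<Omega> t \<Longrightarrow> normalize \<Omega> t = t"
  by (induction \<Omega> t rule: wf_term.induct) (simp_all add: gen_def)

text \<open>Normalizing first makes this a lattice preorder on all terms, so that later structural
  inductions carry no well-formedness hypothesis. Well-formed terms are their own normalizations,
  and on them this is the order of the coproduct.\<close>

definition le :: "'a set \<Rightarrow> 'a eqterm \<Rightarrow> 'a eqterm \<Rightarrow> bool" where
  "le \<Omega> s t \<longleftrightarrow> coprod0_eq \<Omega> (Join (normalize \<Omega> s) (normalize \<Omega> t)) (normalize \<Omega> t)"

lemma coprod0_gen_join:
  "a \<in> EqL \<Omega> \<Longrightarrow> b \<in> EqL \<Omega> \<Longrightarrow> coprod0_eq \<Omega> (gen i (eq_join a b)) (Join (gen i a) (gen i b))"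
  by (cases i) (simp_all add: gen_def coprod0_eq.inl_join coprod0_eq.inr_join)

lemma coprod0_gen_meet:
  "a \<in> EqL \<Omega> \<Longrightarrow> b \<in> EqL \<Omega> \<Longrightarrow> coprod0_eq \<Omega> (gen i (a \<inter> b)) (Meet (gen i a) (gen i b))"
  using coprod0_eq.inl_meet[of a \<Omega> b] coprod0_eq.inr_meet[of a \<Omega> b]
  by (cases i) (simp_all add: gen_def eq_meet_def)

lemma coprod0_gen_zero: "coprod0_eq \<Omega> (gen i (Id_on \<Omega>)) (gen j (Id_on \<Omega>))"
  using coprod0_eq.zeros[of \<Omega>] coprod0_eq.zeros[of \<Omega>, THEN coprod0_eq.sym]
  by (cases i; cases j) (simp_all add: gen_def coprod0_eq.refl)

lemma coprod0_eq_imp_le0: "coprod0_eq \<Omega> s t \<Longrightarrow> coprod0_eq \<Omega> (Join s t) t"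
  by (meson coprod0_eq.cong_join coprod0_eq.join_idem coprod0_eq.refl coprod0_eq.trans)

lemma le0_iff_meet: "coprod0_eq \<Omega> (Join s t) t \<longleftrightarrow> coprod0_eq \<Omega> (Meet s t) s"
proof
  assume "coprod0_eq \<Omega> (Join s t) t"
  then have "coprod0_eq \<Omega> (Meet s t) (Meet s (Join s t))"
    by (meson coprod0_eq.cong_meet coprod0_eq.refl coprod0_eq.sym)
  then show "coprod0_eq \<Omega> (Meet s t) s"
    using coprod0_eq.absorb2 coprod0_eq.trans by blast
next
  assume "coprod0_eq \<Omega> (Meet s t) s"
  then have "coprod0_eq \<Omega> (Join s t) (Join t (Meet t s))"
    by (meson coprod0_eq.cong_join coprod0_eq.join_comm coprod0_eq.meet_comm coprod0_eq.refl
        coprod0_eq.sym coprod0_eq.trans)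
  then show "coprod0_eq \<Omega> (Join s t) t"
    using coprod0_eq.absorb1 coprod0_eq.trans by blast
qed

interpretation le: coprod_preorder \<Omega> "le \<Omega>" for \<Omega> :: "'a set"
proof
  note cong = coprod0_eq.cong_join coprod0_eq.cong_meet
  note refl' = coprod0_eq.refl
  fix s t u :: "'a eqterm" and a b :: "'a rel" and i j
  show "le \<Omega> s s"
    unfolding le_def by (rule coprod0_eq.join_idem)
  show "le \<Omega> s u" if "le \<Omega> s t" "le \<Omega> t u"
    using that unfolding le_def
    by (meson cong refl' coprod0_eq.join_assoc coprod0_eq.sym coprod0_eq.trans)
  show "le \<Omega> s (Join s t)"
    unfolding le_def normalize.simps
    by (meson cong refl' coprod0_eq.join_assoc coprod0_eq.join_idem coprod0_eq.sym coprod0_eq.trans)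
  show "le \<Omega> t (Join s t)"
    unfolding le_def normalize.simps
    by (meson cong refl' coprod0_eq.join_assoc coprod0_eq.join_comm coprod0_eq.join_idem
        coprod0_eq.sym coprod0_eq.trans)
  show "le \<Omega> (Join s t) u" if "le \<Omega> s u" "le \<Omega> t u"
    using that unfolding le_def normalize.simps
    by (meson cong refl' coprod0_eq.join_assoc coprod0_eq.trans)
  show "le \<Omega> (Meet s t) s"
    unfolding le_def normalize.simps
    by (meson coprod0_eq.absorb1 coprod0_eq.join_comm coprod0_eq.trans)
  show "le \<Omega> (Meet s t) t"
    unfolding le_def normalize.simps
    by (meson cong refl' coprod0_eq.absorb1 coprod0_eq.join_comm coprod0_eq.meet_comm coprod0_eq.trans)
  show "le \<Omega> u (Meet s t)" if "le \<Omega> u s" "le \<Omega> u t"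
    using that unfolding le_def normalize.simps le0_iff_meet
    by (meson cong refl' coprod0_eq.meet_assoc coprod0_eq.sym coprod0_eq.trans)
  show "le \<Omega> (gen i a) (gen i b)" if "nrm \<Omega> a \<subseteq> nrm \<Omega> b"
    unfolding le_def normalize_gen
    using coprod0_gen_join[of "nrm \<Omega> a" \<Omega> "nrm \<Omega> b" i] eq_join_absorb[OF _ that, of \<Omega>]
    by (simp add: coprod0_eq.sym)
  show "le \<Omega> (gen i (eq_join a b)) (Join (gen i a) (gen i b))" if "a \<in> EqL \<Omega>" "b \<in> EqL \<Omega>"
    unfolding le_def using that by (simp add: coprod0_eq_imp_le0 coprod0_gen_join)
  show "le \<Omega> (Meet (gen i a) (gen i b)) (gen i (a \<inter> b))" if "a \<in> EqL \<Omega>" "b \<in> EqL \<Omega>"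
    unfolding le_def using that by (simp add: coprod0_eq_imp_le0 coprod0_gen_meet coprod0_eq.sym)
  show "le \<Omega> (gen i (Id_on \<Omega>)) (gen j (Id_on \<Omega>))"
    unfolding le_def by (simp add: coprod0_eq_imp_le0 coprod0_gen_zero)
qed

lemma (in coprod_preorder) normalize_equiv: "Q (normalize \<Omega> t) t \<and> Q t (normalize \<Omega> t)"
  by (induction t) (simp_all add: gen_mono join_mono meet_mono)

text \<open>\<open>sound\<close> turns the defining congruence into \<open>Q\<close>-equivalence,
  and a term is \<open>Q\<close>-equivalent to its normalization because \<open>gen_mono\<close>
  compares generators through \<open>nrm\<close>.\<close>

lemma (in coprod_preorder) le_imp:
  assumes "le \<Omega> s t"
  shows "Q s t"
proof -
  have "Q (Join (normalize \<Omega> s) (normalize \<Omega> t)) (normalize \<Omega> t)"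
    using sound assms unfolding le_def by blast
  then have "Q (normalize \<Omega> s) (normalize \<Omega> t)"
    using join1 transitive by blast
  then show ?thesis
    using normalize_equiv transitive by blast
qed

lemma le_iff_of_coprod0_eq:
  "wf_term \<Omega> s \<Longrightarrow> wf_term \<Omega> t \<Longrightarrow> coprod0_eq \<Omega> s t \<Longrightarrow> le \<Omega> s t \<and> le \<Omega> t s"
  by (simp add: le_def normalize_id coprod0_eq_imp_le0 coprod0_eq.sym)

lemma coprod0_eq_of_le:
  assumes "wf_term \<Omega> s" "wf_term \<Omega> t" "le \<Omega> s t" "le \<Omega> t s"
  shows "coprod0_eq \<Omega> s t"
  using assms unfolding le_def
  by (simp add: normalize_id) (meson coprod0_eq.join_comm coprod0_eq.sym coprod0_eq.trans)

subsection \<open>Whitman's condition\<close>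

text \<open>Day's doubling: in the lattice where the convex set \<open>I\<close> is replaced by \<open>I \<times> {0, 1}\<close>, the value of a
  term \<open>t\<close> with \<open>I t\<close> is \<open>(t, copy I t)\<close>; terms outside \<open>I\<close> have no second component.\<close>

fun copy :: "('g lterm \<Rightarrow> bool) \<Rightarrow> 'g lterm \<Rightarrow> bool" where
  "copy I (Gen g) = False"
| "copy I (Join s t) = (I s \<and> copy I s \<or> I t \<and> copy I t)"
| "copy I (Meet s t) = ((I s \<longrightarrow> copy I s) \<and> (I t \<longrightarrow> copy I t))"

text \<open>Convexity is what transitivity needs: a middle term between two terms of
  \<open>I\<close> is itself in \<open>I\<close>, so the second component is passed on. The laws for
  generators hold because no generator is doubled.\<close>

lemma doubling_preorder:
  assumes convex: "\<And>x y z. I x \<Longrightarrow> I z \<Longrightarrow> le \<Omega> x y \<Longrightarrow> le \<Omega> y z \<Longrightarrow> I y"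
    and no_gen: "\<And>i a. \<not> I (gen i a)"
  shows "coprod_preorder \<Omega> (\<lambda>s t. le \<Omega> s t \<and> (I s \<and> I t \<and> copy I s \<longrightarrow> copy I t))"
proof
  fix s t u :: "'a eqterm"
  let ?Q = "\<lambda>s t. le \<Omega> s t \<and> (I s \<and> I t \<and> copy I s \<longrightarrow> copy I t)"
  show "?Q s u" if "?Q s t" "?Q t u"
    using that convex[of s u t] le.transitive[of \<Omega> s t u] by blast
  show "?Q (Join s t) u" if "?Q s u" "?Q t u"
    using that by (auto simp: le.join_least)
  show "?Q u (Meet s t)" if "?Q u s" "?Q u t"
    using that by (auto simp: le.meet_greatest)
qed (simp_all add: no_gen le.gen_mono le.gen_join le.gen_meet le.gen_zero)

text \<open>Double the interval between the meet and the join. If all four conclusions fail, then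
  \<open>s0\<close>, \<open>s1\<close>, \<open>t0\<close>, \<open>t1\<close> lie outside it, so
  \<open>copy\<close> is vacuously true at the meet and false at the join. This contradicts the
  leastness of \<open>le\<close>.\<close>

lemma whitman:
  assumes le: "le \<Omega> (Meet s0 s1) (Join t0 t1)"
    and no_gen: "\<And>i a. \<not> (le \<Omega> (Meet s0 s1) (gen i a) \<and> le \<Omega> (gen i a) (Join t0 t1))"
  shows "le \<Omega> s0 (Join t0 t1) \<or> le \<Omega> s1 (Join t0 t1) \<or> le \<Omega> (Meet s0 s1) t0 \<or> le \<Omega> (Meet s0 s1) t1"
proof (rule ccontr)
  assume *: "\<not> ?thesis"
  define I where "I x \<longleftrightarrow> le \<Omega> (Meet s0 s1) x \<and> le \<Omega> x (Join t0 t1)" for x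
  have I: "I (Meet s0 s1)" "I (Join t0 t1)" "\<not> I s0" "\<not> I s1" "\<not> I t0" "\<not> I t1"
    using le * by (auto simp: I_def)
  have dbl: "coprod_preorder \<Omega> (\<lambda>s t. le \<Omega> s t \<and> (I s \<and> I t \<and> copy I s \<longrightarrow> copy I t))"
  proof (rule doubling_preorder)
    show "I y" if "I x" "I z" "le \<Omega> x y" "le \<Omega> y z" for x y z
      using that le.transitive[of \<Omega> "Meet s0 s1" x y] le.transitive[of \<Omega> y z "Join t0 t1"]
      by (simp add: I_def)
    show "\<not> I (gen i a)" for i a
      using no_gen by (simp add: I_def)
  qed
  show False
    using coprod_preorder.le_imp[OF dbl le] I by simp
qed

subsection \<open>Finite approximations and lower covers\<close>

definition res :: "'a set \<Rightarrow> 'a set \<Rightarrow> 'a rel \<Rightarrow> 'a rel" where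
  "res \<Omega> A a = Id_on \<Omega> \<union> (nrm \<Omega> a \<inter> A \<times> A)"

lemma res_EqL [simp]: "res \<Omega> A a \<in> EqL \<Omega>"
proof (rule EqL_I)
  note a = EqL_D[OF nrm_EqL[of \<Omega> a]]
  show "res \<Omega> A a \<subseteq> \<Omega> \<times> \<Omega>" "Id_on \<Omega> \<subseteq> res \<Omega> A a"
    using a(1) by (auto simp: res_def)
  show "(y, x) \<in> res \<Omega> A a" if "(x, y) \<in> res \<Omega> A a" for x y
    using that a(3) by (auto simp: res_def)
  show "(x, z) \<in> res \<Omega> A a" if "(x, y) \<in> res \<Omega> A a" "(y, z) \<in> res \<Omega> A a" for x y z
    using that a(4)[of x y z] by (auto simp: res_def)
qed

lemma res_mono: "A \<subseteq> B \<Longrightarrow> nrm \<Omega> a \<subseteq> nrm \<Omega> b \<Longrightarrow> res \<Omega> A a \<subseteq> res \<Omega> B b"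
  by (auto simp: res_def)

lemma res_subset: "res \<Omega> A a \<subseteq> nrm \<Omega> a"
  using EqL_D(2)[OF nrm_EqL] by (auto simp: res_def)

lemma res_res: "res \<Omega> A (res \<Omega> A a) = res \<Omega> A a"
  unfolding res_def[of \<Omega> A "res \<Omega> A a"] nrm_id[OF res_EqL] by (auto simp: res_def)

lemma res_Id_on [simp]: "res \<Omega> A (Id_on \<Omega>) = Id_on \<Omega>"
  by (auto simp: res_def)

text \<open>Truncations grow with the finite set, and the filter combines finitely many demands on
  that set without naming unions.\<close>

abbreviation eventually_finite :: "('a set \<Rightarrow> bool) \<Rightarrow> bool" where
  "eventually_finite P \<equiv> eventually P (finite_subsets_at_top UNIV)"

lemma eventually_finiteI:
  assumes "finite B" "\<And>A. B \<subseteq> A \<Longrightarrow> P A"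
  shows "eventually_finite P"
  unfolding eventually_finite_subsets_at_top using assms by blast

lemma eventually_finite_happens:
  assumes "eventually_finite P"
  shows "\<exists>A. finite A \<and> P A"
  using assms unfolding eventually_finite_subsets_at_top by blast

lemma eventually_res:
  assumes "(x, y) \<in> nrm \<Omega> a"
  shows "eventually_finite (\<lambda>A. (x, y) \<in> res \<Omega> A a)"
  by (rule eventually_finiteI[of "{x, y}"]) (use assms in \<open>auto simp: res_def\<close>)

text \<open>Membership in a transitive closure is witnessed by a finite chain, so only finitely many
  links have to be captured.\<close>

lemma eventually_eq_join:
  assumes "(x, y) \<in> eq_join a b"
    and a: "\<And>x y. (x, y) \<in> a \<Longrightarrow> eventually_finite (\<lambda>A. (x, y) \<in> f A)"
    and b: "\<And>x y. (x, y) \<in> b \<Longrightarrow> eventually_finite (\<lambda>A. (x, y) \<in> g A)"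
  shows "eventually_finite (\<lambda>A. (x, y) \<in> eq_join (f A) (g A))"
proof -
  have ab: "eventually_finite (\<lambda>A. (x, y) \<in> f A \<union> g A)" if "(x, y) \<in> a \<union> b" for x y
    using that
  proof
    assume "(x, y) \<in> a"
    from a[OF this] show ?thesis
      by eventually_elim simp
  next
    assume "(x, y) \<in> b"
    from b[OF this] show ?thesis
      by eventually_elim simp
  qed
  show ?thesis
    using assms(1) unfolding eq_join_def
  proof (induction rule: trancl_induct)
    case (base y)
    from ab[OF this] show ?case
      by eventually_elim (rule r_into_trancl)
  next
    case (step y z)
    from step.IH ab[OF step.hyps(2)] show ?case
      by eventually_elim (rule trancl_into_trancl)
  qed
qed

text \<open>Only finitely many pairs of the join lie in \<open>A \<times> A\<close>, and each of
  them is captured eventually.\<close>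

lemma res_eq_join_compact:
  assumes a: "a \<in> EqL \<Omega>" and b: "b \<in> EqL \<Omega>" and "finite A"
  shows "\<exists>B. finite B \<and> res \<Omega> A (eq_join a b) \<subseteq> eq_join (res \<Omega> B a) (res \<Omega> B b)"
proof -
  have "eventually_finite (\<lambda>B. p \<in> eq_join (res \<Omega> B a) (res \<Omega> B b))"
    if "p \<in> eq_join a b \<inter> A \<times> A" for p
    using that eventually_eq_join[of "fst p" "snd p" a b "\<lambda>B. res \<Omega> B a" "\<lambda>B. res \<Omega> B b"]
      eventually_res[of _ _ \<Omega> a] eventually_res[of _ _ \<Omega> b] a b by simp
  then have "eventually_finite (\<lambda>B. \<forall>p\<in>eq_join a b \<inter> A \<times> A. p \<in> eq_join (res \<Omega> B a) (res \<Omega> B b))"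
    using \<open>finite A\<close> by (intro eventually_ball_finite) auto
  then obtain B where B: "finite B" "\<forall>p\<in>eq_join a b \<inter> A \<times> A. p \<in> eq_join (res \<Omega> B a) (res \<Omega> B b)"
    using eventually_finite_happens by blast
  have "Id_on \<Omega> \<subseteq> eq_join (res \<Omega> B a) (res \<Omega> B b)"
    by (intro EqL_D(2) eq_join_EqL res_EqL)
  then have "res \<Omega> A (eq_join a b) \<subseteq> eq_join (res \<Omega> B a) (res \<Omega> B b)"
    using B(2) a b by (auto simp: res_def)
  then show ?thesis
    using B(1) by blast
qed

fun trunc :: "'a set \<Rightarrow> 'a set \<Rightarrow> 'a eqterm \<Rightarrow> 'a eqterm" where
  "trunc \<Omega> A (Gen g) = gen (side g) (res \<Omega> A (val g))"
| "trunc \<Omega> A (Join s t) = Join (trunc \<Omega> A s) (trunc \<Omega> A t)"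
| "trunc \<Omega> A (Meet s t) = Meet (trunc \<Omega> A s) (trunc \<Omega> A t)"

lemma trunc_gen [simp]: "trunc \<Omega> A (gen i a) = gen i (res \<Omega> A a)"
  by (simp add: gen_def)

lemma trunc_mono: "A \<subseteq> B \<Longrightarrow> le \<Omega> (trunc \<Omega> A t) (trunc \<Omega> B t)"
  by (induction t) (simp_all add: le.join_mono le.meet_mono le.gen_mono res_mono)

lemma trunc_le: "le \<Omega> (trunc \<Omega> A t) t"
  by (induction t) (simp_all add: le.join_mono le.meet_mono le.gen_mono res_subset)

lemma trunc_trunc: "trunc \<Omega> A (trunc \<Omega> A t) = trunc \<Omega> A t"
  by (induction t) (simp_all add: res_res)

text \<open>Truncation at one fixed set does not respect \<open>le\<close>: a chain linking two
  points of \<open>A\<close> in \<open>eq_join a b\<close> may run outside \<open>A\<close>. The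
  existential \<open>B\<close> absorbs this; meets of generators need no enlargement.\<close>

lemma trunc_preorder:
  "coprod_preorder \<Omega> (\<lambda>s t. \<forall>A. finite A \<longrightarrow> (\<exists>B. finite B \<and> le \<Omega> (trunc \<Omega> A s) (trunc \<Omega> B t)))"
  (is "coprod_preorder \<Omega> ?Q")
proof
  fix s t u :: "'a eqterm" and a b :: "'a rel" and i j
  have direct: "?Q s t" if "\<And>A. le \<Omega> (trunc \<Omega> A s) (trunc \<Omega> A t)" for s t
    using that by blast
  show "?Q s s" "?Q s (Join s t)" "?Q t (Join s t)" "?Q (Meet s t) s" "?Q (Meet s t) t"
    by (rule direct; simp)+
  show "?Q s u" if "?Q s t" "?Q t u"
    using that le.transitive by meson
  show "?Q (Join s t) u" if st: "?Q s u" "?Q t u"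
  proof (intro allI impI)
    fix A :: "'a set"
    assume "finite A"
    then obtain B C where B: "finite B" "le \<Omega> (trunc \<Omega> A s) (trunc \<Omega> B u)"
      and C: "finite C" "le \<Omega> (trunc \<Omega> A t) (trunc \<Omega> C u)"
      using st by meson
    have "le \<Omega> (trunc \<Omega> A (Join s t)) (trunc \<Omega> (B \<union> C) u)"
      using le.transitive[OF B(2) trunc_mono[of B "B \<union> C"]] le.transitive[OF C(2) trunc_mono[of C "B \<union> C"]]
      by (simp add: le.join_least)
    then show "\<exists>B. finite B \<and> le \<Omega> (trunc \<Omega> A (Join s t)) (trunc \<Omega> B u)"
      using B(1) C(1) by blast
  qed
  show "?Q u (Meet s t)" if st: "?Q u s" "?Q u t"
  proof (intro allI impI)
    fix A :: "'a set"
    assume "finite A"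
    then obtain B C where B: "finite B" "le \<Omega> (trunc \<Omega> A u) (trunc \<Omega> B s)"
      and C: "finite C" "le \<Omega> (trunc \<Omega> A u) (trunc \<Omega> C t)"
      using st by meson
    have "le \<Omega> (trunc \<Omega> A u) (trunc \<Omega> (B \<union> C) (Meet s t))"
      using le.transitive[OF B(2) trunc_mono[of B "B \<union> C"]] le.transitive[OF C(2) trunc_mono[of C "B \<union> C"]]
      by (simp add: le.meet_greatest)
    then show "\<exists>B. finite B \<and> le \<Omega> (trunc \<Omega> A u) (trunc \<Omega> B (Meet s t))"
      using B(1) C(1) by blast
  qed
  show "?Q (gen i a) (gen i b)" if "nrm \<Omega> a \<subseteq> nrm \<Omega> b"
    by (rule direct) (use that in \<open>simp add: le.gen_mono res_mono\<close>)
  show "?Q (gen i (eq_join a b)) (Join (gen i a) (gen i b))" if ab: "a \<in> EqL \<Omega>" "b \<in> EqL \<Omega>"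
  proof (intro allI impI)
    fix A :: "'a set"
    assume "finite A"
    then obtain B where B: "finite B" "res \<Omega> A (eq_join a b) \<subseteq> eq_join (res \<Omega> B a) (res \<Omega> B b)"
      using res_eq_join_compact[OF ab] by blast
    have "le \<Omega> (gen i (res \<Omega> A (eq_join a b))) (gen i (eq_join (res \<Omega> B a) (res \<Omega> B b)))"
      using B(2) by (simp add: le.gen_mono)
    then have "le \<Omega> (trunc \<Omega> A (gen i (eq_join a b))) (trunc \<Omega> B (Join (gen i a) (gen i b)))"
      using le.transitive[OF _ le.gen_join[OF res_EqL res_EqL]] by simp
    then show "\<exists>B. finite B \<and> le \<Omega> (trunc \<Omega> A (gen i (eq_join a b))) (trunc \<Omega> B (Join (gen i a) (gen i b)))"
      using B(1) by blast
  qed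
  show "?Q (Meet (gen i a) (gen i b)) (gen i (a \<inter> b))" if ab: "a \<in> EqL \<Omega>" "b \<in> EqL \<Omega>"
  proof (rule direct)
    fix A :: "'a set"
    have "res \<Omega> A a \<inter> res \<Omega> A b = res \<Omega> A (a \<inter> b)"
      using ab by (auto simp: res_def)
    then show "le \<Omega> (trunc \<Omega> A (Meet (gen i a) (gen i b))) (trunc \<Omega> A (gen i (a \<inter> b)))"
      using le.gen_meet[of "res \<Omega> A a" \<Omega> "res \<Omega> A b" i] by simp
  qed
  show "?Q (gen i (Id_on \<Omega>)) (gen j (Id_on \<Omega>))"
    by (rule direct) (simp add: le.gen_zero)
qed

text \<open>The previous preorder is applied to \<open>trunc \<Omega> A s\<close> at the same set
  \<open>A\<close>, where truncating again changes nothing.\<close>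

lemma trunc_compact:
  assumes "le \<Omega> (trunc \<Omega> A s) t" "finite A"
  shows "\<exists>B. finite B \<and> le \<Omega> (trunc \<Omega> A s) (trunc \<Omega> B t)"
  using coprod_preorder.le_imp[OF trunc_preorder assms(1), rule_format, OF assms(2)]
  unfolding trunc_trunc .

text \<open>The retraction of the coproduct onto its factor \<open>i\<close> that sends the other
  factor to zero. It lies below the identity (\<open>low_le\<close>), so it picks the largest
  generator of side \<open>i\<close> below a term.\<close>

fun low :: "'a set \<Rightarrow> bool \<Rightarrow> 'a eqterm \<Rightarrow> 'a rel" where
  "low \<Omega> i (Gen g) = (if i = side g then nrm \<Omega> (val g) else Id_on \<Omega>)"
| "low \<Omega> i (Join s t) = eq_join (low \<Omega> i s) (low \<Omega> i t)"
| "low \<Omega> i (Meet s t) = low \<Omega> i s \<inter> low \<Omega> i t"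

lemma low_gen [simp]: "low \<Omega> i (gen j a) = (if i = j then nrm \<Omega> a else Id_on \<Omega>)"
  by (simp add: gen_def)

lemma low_EqL [simp]: "low \<Omega> i t \<in> EqL \<Omega>"
  by (induction t) simp_all

lemma low_mono: "le \<Omega> s t \<Longrightarrow> low \<Omega> i s \<subseteq> low \<Omega> i t"
proof -
  interpret low: coprod_preorder \<Omega> "\<lambda>s t. low \<Omega> i s \<subseteq> low \<Omega> i t"
  proof
    show "low \<Omega> i (Join s t) \<subseteq> low \<Omega> i u" if "low \<Omega> i s \<subseteq> low \<Omega> i u" "low \<Omega> i t \<subseteq> low \<Omega> i u" for s t u
      using that by (simp add: eq_join_least[OF low_EqL])
  qed (auto simp: eq_join_upper)
  show "le \<Omega> s t \<Longrightarrow> low \<Omega> i s \<subseteq> low \<Omega> i t"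
    by (rule low.le_imp)
qed

lemma low_le: "le \<Omega> (gen i (low \<Omega> i t)) t"
proof (induction t)
  case (gen j a)
  then show ?case
    using le.transitive[OF le.gen_zero[of \<Omega> i j] le.gen_mono[of \<Omega> "Id_on \<Omega>" a j]] EqL_D(2)[OF nrm_EqL]
    by (auto intro: le.gen_mono)
next
  case (Join s t)
  then show ?case
    using le.transitive[OF le.gen_join[OF low_EqL low_EqL] le.join_mono[OF Join.IH]] by simp
next
  case (Meet s t)
  have "le \<Omega> (gen i (low \<Omega> i (Meet s t))) (gen i (low \<Omega> i s))"
    "le \<Omega> (gen i (low \<Omega> i (Meet s t))) (gen i (low \<Omega> i t))"
    by (auto intro!: le.gen_mono)
  then show ?case
    using Meet.IH by (meson le.meet_greatest le.transitive)
qed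

lemma gen_le_low: "le \<Omega> (gen i a) t \<Longrightarrow> le \<Omega> (gen i a) (gen i (low \<Omega> i t))"
  using low_mono[of \<Omega> "gen i a" t i] by (simp add: le.gen_mono)

subsection \<open>Upper covers\<close>

text \<open>The value at \<open>i\<close> stands for the least generator of side \<open>i\<close> above a term. The pair
  \<open>(True, \<Omega> \<times> \<Omega>)\<close> says that there is none. A term below the common zero of both sides must get
  the bound zero on both sides, whence \<open>collapse\<close>.\<close>

type_synonym 'a bounds = "bool \<Rightarrow> bool \<times> 'a rel"

definition vzero :: "'a set \<Rightarrow> 'a bounds" where
  "vzero \<Omega> = (\<lambda>_. (False, Id_on \<Omega>))"

definition collapse :: "'a set \<Rightarrow> 'a bounds \<Rightarrow> 'a bounds" where
  "collapse \<Omega> v = (if \<exists>i. v i = (False, Id_on \<Omega>) then vzero \<Omega> else v)"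

definition vjoin :: "'a bounds \<Rightarrow> 'a bounds \<Rightarrow> 'a bounds" where
  "vjoin v w = (\<lambda>i. (fst (v i) \<or> fst (w i), eq_join (snd (v i)) (snd (w i))))"

text \<open>The placeholder \<Omega> \<times> \<Omega> of a missing bound is neutral for
  intersection, so one formula covers meets with and without bounds. The flag separates a missing
  bound from the genuine bound \<Omega> \<times> \<Omega>.\<close>

definition vmeet :: "'a bounds \<Rightarrow> 'a bounds \<Rightarrow> 'a bounds" where
  "vmeet v w = (\<lambda>i. (fst (v i) \<and> fst (w i), snd (v i) \<inter> snd (w i)))"

definition vgen :: "'a set \<Rightarrow> bool \<Rightarrow> 'a rel \<Rightarrow> 'a bounds" where
  "vgen \<Omega> i a = (\<lambda>j. if j = i then (False, a) else (True, \<Omega> \<times> \<Omega>))"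

fun up :: "'a set \<Rightarrow> 'a eqterm \<Rightarrow> 'a bounds" where
  "up \<Omega> (Gen g) = collapse \<Omega> (vgen \<Omega> (side g) (nrm \<Omega> (val g)))"
| "up \<Omega> (Join s t) = vjoin (up \<Omega> s) (up \<Omega> t)"
| "up \<Omega> (Meet s t) = collapse \<Omega> (vmeet (up \<Omega> s) (up \<Omega> t))"

lemma up_gen [simp]: "up \<Omega> (gen i a) = collapse \<Omega> (vgen \<Omega> i (nrm \<Omega> a))"
  by (simp add: gen_def)

definition vle :: "'a bounds \<Rightarrow> 'a bounds \<Rightarrow> bool" where
  "vle v w \<longleftrightarrow> (\<forall>i. (fst (v i) \<longrightarrow> fst (w i)) \<and> snd (v i) \<subseteq> snd (w i))"

definition vok :: "'a set \<Rightarrow> 'a bounds \<Rightarrow> bool" where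
  "vok \<Omega> v \<longleftrightarrow> (\<forall>i. snd (v i) \<in> EqL \<Omega> \<and> (fst (v i) \<longrightarrow> snd (v i) = \<Omega> \<times> \<Omega>))"

lemma vok_zero: "vok \<Omega> (vzero \<Omega>)"
  by (simp add: vok_def vzero_def)

lemma vok_collapse: "vok \<Omega> v \<Longrightarrow> vok \<Omega> (collapse \<Omega> v)"
  by (simp add: collapse_def vok_zero)

lemma vok_up: "vok \<Omega> (up \<Omega> t)"
proof (induction t)
  case (gen i a)
  show ?case
    unfolding up_gen by (rule vok_collapse) (simp add: vok_def vgen_def)
next
  case (Join s t)
  have "eq_join (\<Omega> \<times> \<Omega>) r = \<Omega> \<times> \<Omega>" "eq_join r (\<Omega> \<times> \<Omega>) = \<Omega> \<times> \<Omega>" if "r \<in> EqL \<Omega>" for r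
    using eq_join_absorb[OF Times_EqL EqL_D(1)[OF that]] by (simp_all add: eq_join_commute)
  then show ?case
    using Join by (auto simp: vok_def vjoin_def)
next
  case (Meet s t)
  then show ?case
    unfolding up.simps by (intro vok_collapse) (auto simp: vok_def vmeet_def)
qed

text \<open>This is why \<open>up\<close> needs no \<open>collapse\<close> at joins: a join with
  bound zero on one side has both arguments zero on that side, hence by induction on both
  sides.\<close>

lemma up_zero:
  assumes "up \<Omega> t i = (False, Id_on \<Omega>)"
  shows "up \<Omega> t = vzero \<Omega>"
  using assms
proof (induction t)
  case (gen i a)
  then show ?case by (auto simp: collapse_def)
next
  case (Join s t)
  have "snd (up \<Omega> s i) \<in> EqL \<Omega>" "snd (up \<Omega> t i) \<in> EqL \<Omega>"
    using vok_up by (auto simp: vok_def)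
  moreover have "eq_join (snd (up \<Omega> s i)) (snd (up \<Omega> t i)) = Id_on \<Omega>"
    "\<not> fst (up \<Omega> s i)" "\<not> fst (up \<Omega> t i)"
    using Join.prems by (auto simp: vjoin_def)
  ultimately have "up \<Omega> s i = (False, Id_on \<Omega>)" "up \<Omega> t i = (False, Id_on \<Omega>)"
    using EqL_D(2) eq_join_upper by (metis prod.collapse subset_antisym)+
  then have "up \<Omega> s = vzero \<Omega>" "up \<Omega> t = vzero \<Omega>"
    using Join.IH by blast+
  then show ?case
    by (simp add: vjoin_def vzero_def eq_join_absorb[of _ \<Omega>])
next
  case (Meet s t)
  then show ?case by (auto simp: collapse_def)
qed

lemma vle_refl [simp]: "vle v v"
  by (simp add: vle_def)

lemma vle_trans: "vle u v \<Longrightarrow> vle v w \<Longrightarrow> vle u w"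
  unfolding vle_def by blast

lemma zero_vle: "vok \<Omega> v \<Longrightarrow> vle (vzero \<Omega>) v"
  using EqL_D(2) unfolding vle_def vok_def vzero_def by fastforce

lemma collapse_vle: "vok \<Omega> v \<Longrightarrow> vle (collapse \<Omega> v) v"
  by (simp add: collapse_def zero_vle)

lemma vle_zero_component:
  assumes "vok \<Omega> v" "vle v w" "w i = (False, Id_on \<Omega>)"
  shows "v i = (False, Id_on \<Omega>)"
proof -
  have "\<not> fst (v i)" "snd (v i) \<subseteq> Id_on \<Omega>" "Id_on \<Omega> \<subseteq> snd (v i)"
    using assms EqL_D(2) unfolding vle_def vok_def by (metis fst_conv, metis snd_conv, blast)
  then show ?thesis
    by (simp add: prod_eq_iff)
qed

text \<open>\<open>collapse\<close> may lower \<open>v\<close> only if \<open>v\<close> has a zero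
  component. Then \<open>up \<Omega> t\<close> has one too, and is zero throughout by
  \<open>up_zero\<close>.\<close>

lemma up_vle_collapse:
  assumes "vle (up \<Omega> t) v" "vok \<Omega> v"
  shows "vle (up \<Omega> t) (collapse \<Omega> v)"
proof (cases "\<exists>i. v i = (False, Id_on \<Omega>)")
  case True
  then have "up \<Omega> t = vzero \<Omega>"
    using vle_zero_component[OF vok_up assms(1)] up_zero by blast
  then show ?thesis
    using zero_vle[OF vok_collapse[OF assms(2)]] by simp
next
  case False
  then show ?thesis
    using assms(1) by (simp add: collapse_def)
qed

lemma vok_vgen: "a \<in> EqL \<Omega> \<Longrightarrow> vok \<Omega> (vgen \<Omega> i a)"
  by (simp add: vok_def vgen_def)

lemma vok_vmeet: "vok \<Omega> v \<Longrightarrow> vok \<Omega> w \<Longrightarrow> vok \<Omega> (vmeet v w)"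
  by (auto simp: vok_def vmeet_def)

lemma vmeet_mono: "vle v v' \<Longrightarrow> vle w w' \<Longrightarrow> vle (vmeet v w) (vmeet v' w')"
  unfolding vle_def vmeet_def fst_conv snd_conv by (meson Int_mono)

lemma vgen_Int: "vgen \<Omega> i (a \<inter> b) = vmeet (vgen \<Omega> i a) (vgen \<Omega> i b)"
  by (simp add: vgen_def vmeet_def fun_eq_iff)

lemma up_preorder: "coprod_preorder \<Omega> (\<lambda>s t. vle (up \<Omega> s) (up \<Omega> t))"
proof
  fix s t u :: "'a eqterm" and a b :: "'a rel" and i j
  show "vle (up \<Omega> s) (up \<Omega> s)"
    by simp
  show "vle (up \<Omega> s) (up \<Omega> u)" if "vle (up \<Omega> s) (up \<Omega> t)" "vle (up \<Omega> t) (up \<Omega> u)"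
    using that by (rule vle_trans)
  show j1: "vle (up \<Omega> s) (up \<Omega> (Join s t))" for s t
    by (simp add: vle_def vjoin_def eq_join_upper)
  show j2: "vle (up \<Omega> t) (up \<Omega> (Join s t))" for s t
    by (simp add: vle_def vjoin_def eq_join_upper)
  show "vle (up \<Omega> (Join s t)) (up \<Omega> u)" if "vle (up \<Omega> s) (up \<Omega> u)" "vle (up \<Omega> t) (up \<Omega> u)"
    using that vok_up[of \<Omega> u] unfolding vle_def vjoin_def vok_def up.simps fst_conv snd_conv
    by (meson eq_join_least)
  have m: "vle (up \<Omega> (Meet s t)) (vmeet (up \<Omega> s) (up \<Omega> t))"
    by (simp add: collapse_vle vok_vmeet vok_up)
  show "vle (up \<Omega> (Meet s t)) (up \<Omega> s)"
    by (rule vle_trans[OF m]) (simp add: vle_def vmeet_def)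
  show "vle (up \<Omega> (Meet s t)) (up \<Omega> t)"
    by (rule vle_trans[OF m]) (simp add: vle_def vmeet_def)
  show "vle (up \<Omega> u) (up \<Omega> (Meet s t))" if "vle (up \<Omega> u) (up \<Omega> s)" "vle (up \<Omega> u) (up \<Omega> t)"
    unfolding up.simps using that
    by (intro up_vle_collapse vok_vmeet vok_up) (simp add: vle_def vmeet_def)
  show mono: "vle (up \<Omega> (gen i a)) (up \<Omega> (gen i b))" if "nrm \<Omega> a \<subseteq> nrm \<Omega> b" for a b
  proof -
    have "vle (up \<Omega> (gen i a)) (vgen \<Omega> i (nrm \<Omega> a))"
      by (simp add: collapse_vle vok_vgen)
    also have "vle (vgen \<Omega> i (nrm \<Omega> a)) (vgen \<Omega> i (nrm \<Omega> b))"
      using that by (simp add: vle_def vgen_def)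
    finally (vle_trans) show ?thesis
      unfolding up_gen[of \<Omega> i b] by (rule up_vle_collapse) (simp add: vok_vgen)
  qed
  show "vle (up \<Omega> (gen i (eq_join a b))) (up \<Omega> (Join (gen i a) (gen i b)))"
    if ab: "a \<in> EqL \<Omega>" "b \<in> EqL \<Omega>"
  proof -
    \<comment> \<open>A zero generator is collapsed on the other side as well, so \<open>up\<close>
      agrees with \<open>vgen\<close> on both generators only if both are nonzero. Otherwise the
      join is one of the two arguments.\<close>
    consider "a = Id_on \<Omega>" | "b = Id_on \<Omega>" | "a \<noteq> Id_on \<Omega>" "b \<noteq> Id_on \<Omega>"
      by blast
    then show ?thesis
    proof cases
      case 1
      then have "eq_join a b = b"
        using eq_join_absorb[OF ab(2)] EqL_D(2)[OF ab(2)] by simp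
      then show ?thesis
        by (simp only: j2)
    next
      case 2
      then have "eq_join a b = a"
        using eq_join_absorb[OF ab(1)] EqL_D(2)[OF ab(1)] by (simp add: eq_join_commute[of a])
      then show ?thesis
        by (simp only: j1)
    next
      case 3
      have "vle (up \<Omega> (gen i (eq_join a b))) (vgen \<Omega> i (eq_join a b))"
        using ab by (simp add: collapse_vle vok_vgen)
      moreover have "vle (vgen \<Omega> i (eq_join a b)) (up \<Omega> (Join (gen i a) (gen i b)))"
      proof -
        have "collapse \<Omega> (vgen \<Omega> i a) = vgen \<Omega> i a" "collapse \<Omega> (vgen \<Omega> i b) = vgen \<Omega> i b"
          using 3 by (simp_all add: collapse_def vgen_def)
        then show ?thesis
          using ab by (simp add: vgen_def vle_def vjoin_def eq_join_absorb[OF Times_EqL])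
      qed
      ultimately show ?thesis
        by (rule vle_trans)
    qed
  qed
  show "vle (up \<Omega> (Meet (gen i a) (gen i b))) (up \<Omega> (gen i (a \<inter> b)))"
    if ab: "a \<in> EqL \<Omega>" "b \<in> EqL \<Omega>"
  proof -
    have "vle (up \<Omega> (gen i a)) (vgen \<Omega> i a)" "vle (up \<Omega> (gen i b)) (vgen \<Omega> i b)"
      using ab by (simp_all add: collapse_vle vok_vgen)
    then have "vle (vmeet (up \<Omega> (gen i a)) (up \<Omega> (gen i b))) (vgen \<Omega> i (a \<inter> b))"
      unfolding vgen_Int by (rule vmeet_mono)
    then have "vle (up \<Omega> (Meet (gen i a) (gen i b))) (vgen \<Omega> i (a \<inter> b))"
      unfolding up.simps by (rule vle_trans[OF collapse_vle[OF vok_vmeet[OF vok_up vok_up]]])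
    then show ?thesis
      unfolding up_gen[of \<Omega> i "a \<inter> b"] using ab by (simp only: nrm_id Int_EqL up_vle_collapse vok_vgen)
  qed
  show "vle (up \<Omega> (gen i (Id_on \<Omega>))) (up \<Omega> (gen j (Id_on \<Omega>)))"
    by (auto simp: collapse_def vgen_def)
qed

lemma up_mono: "le \<Omega> s t \<Longrightarrow> vle (up \<Omega> s) (up \<Omega> t)"
  by (rule coprod_preorder.le_imp[OF up_preorder])

lemma up_gen_component: "up \<Omega> (gen i a) i = (False, nrm \<Omega> a)"
  by (auto simp: collapse_def vgen_def vzero_def split: if_splits)

text \<open>The recorded bounds are attained; \<open>up_mono\<close> and
  \<open>up_gen_component\<close> show that they are least.\<close>

lemma le_gen_up: "\<not> fst (up \<Omega> t i) \<Longrightarrow> le \<Omega> t (gen i (snd (up \<Omega> t i)))"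
proof (induction t arbitrary: i)
  case (gen j a)
  show ?case
  proof (cases "nrm \<Omega> a = Id_on \<Omega>")
    case True
    then have "up \<Omega> (gen j a) = vzero \<Omega>"
      by (auto simp: collapse_def vgen_def)
    moreover have "le \<Omega> (gen j a) (gen j (Id_on \<Omega>))"
      using True by (simp add: le.gen_mono)
    ultimately show ?thesis
      using le.transitive[OF _ le.gen_zero] by (simp add: vzero_def)
  next
    case False
    then show ?thesis
      using gen by (auto simp: collapse_def vgen_def le.gen_mono split: if_splits)
  qed
next
  case (Join s t)
  have nf: "\<not> fst (up \<Omega> s i)" "\<not> fst (up \<Omega> t i)"
    using Join.prems by (auto simp: vjoin_def)
  have EqL: "snd (up \<Omega> s i) \<in> EqL \<Omega>" "snd (up \<Omega> t i) \<in> EqL \<Omega>"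
    using vok_up by (auto simp: vok_def)
  have "le \<Omega> (gen i (snd (up \<Omega> s i))) (gen i (snd (up \<Omega> (Join s t) i)))"
    "le \<Omega> (gen i (snd (up \<Omega> t i))) (gen i (snd (up \<Omega> (Join s t) i)))"
    using EqL by (simp_all add: vjoin_def eq_join_upper le.gen_mono)
  then show ?case
    using le.transitive[OF Join.IH(1)[OF nf(1)]] le.transitive[OF Join.IH(2)[OF nf(2)]]
    by (blast intro: le.join_least)
next
  case (Meet s t)
  have EqL: "snd (up \<Omega> s i) \<in> EqL \<Omega>" "snd (up \<Omega> t i) \<in> EqL \<Omega>" for i
    using vok_up by (auto simp: vok_def)
  \<comment> \<open>The claim before collapsing. If one side then has bound zero,
    \<open>gen_zero\<close> transfers that bound to the other side.\<close>
  have meet: "le \<Omega> (Meet s t) (gen i (snd (vmeet (up \<Omega> s) (up \<Omega> t) i)))"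
    if nfst: "\<not> fst (vmeet (up \<Omega> s) (up \<Omega> t) i)" for i
  proof (cases "fst (up \<Omega> s i) \<or> fst (up \<Omega> t i)")
    case False
    then have "le \<Omega> s (gen i (snd (up \<Omega> s i)))" "le \<Omega> t (gen i (snd (up \<Omega> t i)))"
      using Meet.IH by blast+
    then show ?thesis
      using le.transitive[OF le.meet_mono le.gen_meet[OF EqL]] by (simp add: vmeet_def)
  next
    case True
    then consider "fst (up \<Omega> s i)" "\<not> fst (up \<Omega> t i)" | "\<not> fst (up \<Omega> s i)" "fst (up \<Omega> t i)"
      using nfst by (auto simp: vmeet_def)
    then show ?thesis
    proof cases
      case 1
      then have "snd (vmeet (up \<Omega> s) (up \<Omega> t) i) = snd (up \<Omega> t i)"
        using vok_up[of \<Omega> s] EqL_D(1)[OF EqL(2)] by (auto simp: vmeet_def vok_def)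
      then show ?thesis
        using le.transitive[OF le.meet2 Meet.IH(2)[OF 1(2)]] by simp
    next
      case 2
      then have "snd (vmeet (up \<Omega> s) (up \<Omega> t) i) = snd (up \<Omega> s i)"
        using vok_up[of \<Omega> t] EqL_D(1)[OF EqL(1)] by (auto simp: vmeet_def vok_def)
      then show ?thesis
        using le.transitive[OF le.meet1 Meet.IH(1)[OF 2(1)]] by simp
    qed
  qed
  show ?case
  proof (cases "\<exists>j. vmeet (up \<Omega> s) (up \<Omega> t) j = (False, Id_on \<Omega>)")
    case True
    then obtain j where j: "vmeet (up \<Omega> s) (up \<Omega> t) j = (False, Id_on \<Omega>)"
      by blast
    have "le \<Omega> (Meet s t) (gen j (Id_on \<Omega>))"
      using meet[of j] j by simp
    moreover have "up \<Omega> (Meet s t) = vzero \<Omega>"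
      using True by (simp add: collapse_def)
    ultimately show ?thesis
      using le.transitive[OF _ le.gen_zero] by (simp add: vzero_def)
  next
    case False
    then show ?thesis
      using meet[of i] Meet.prems by (simp add: collapse_def)
  qed
qed

section \<open>Continuity of the least upper generators under truncation\<close>

definition approx :: "'a bounds \<Rightarrow> ('a set \<Rightarrow> 'a bounds) \<Rightarrow> bool" where
  "approx v f \<longleftrightarrow> (\<forall>i. (\<forall>p\<in>snd (v i). eventually_finite (\<lambda>A. p \<in> snd (f A i))) \<and>
    (fst (v i) \<longrightarrow> eventually_finite (\<lambda>A. fst (f A i))))"

lemma approxD:
  assumes "approx v f"
  shows "p \<in> snd (v i) \<Longrightarrow> eventually_finite (\<lambda>A. p \<in> snd (f A i))"
    and "fst (v i) \<Longrightarrow> eventually_finite (\<lambda>A. fst (f A i))"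
  using assms unfolding approx_def by blast+

lemma approx_vgen: "approx (vgen \<Omega> i (nrm \<Omega> a)) (\<lambda>A. vgen \<Omega> i (res \<Omega> A a))"
  unfolding approx_def vgen_def by (auto intro: eventually_res)

lemma approx_vjoin:
  assumes "approx v f" "approx w g"
  shows "approx (vjoin v w) (\<lambda>A. vjoin (f A) (g A))"
  unfolding approx_def
proof (intro allI conjI ballI impI)
  fix i p
  assume "p \<in> snd (vjoin v w i)"
  then show "eventually_finite (\<lambda>A. p \<in> snd (vjoin (f A) (g A) i))"
    unfolding vjoin_def snd_conv
    using eventually_eq_join[of "fst p" "snd p" "snd (v i)" "snd (w i)" "\<lambda>A. snd (f A i)" "\<lambda>A. snd (g A i)"]
      approxD(1)[OF assms(1)] approxD(1)[OF assms(2)] by simp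
next
  fix i
  assume "fst (vjoin v w i)"
  then consider "fst (v i)" | "fst (w i)"
    by (auto simp: vjoin_def)
  then show "eventually_finite (\<lambda>A. fst (vjoin (f A) (g A) i))"
  proof cases
    case 1
    from approxD(2)[OF assms(1) 1] show ?thesis
      by eventually_elim (simp add: vjoin_def)
  next
    case 2
    from approxD(2)[OF assms(2) 2] show ?thesis
      by eventually_elim (simp add: vjoin_def)
  qed
qed

lemma approx_vmeet:
  assumes "approx v f" "approx w g"
  shows "approx (vmeet v w) (\<lambda>A. vmeet (f A) (g A))"
  unfolding approx_def
proof (intro allI conjI ballI impI)
  fix i p
  assume "p \<in> snd (vmeet v w i)"
  then have "p \<in> snd (v i)" "p \<in> snd (w i)"
    by (simp_all add: vmeet_def)
  from approxD(1)[OF assms(1) this(1)] approxD(1)[OF assms(2) this(2)]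
  show "eventually_finite (\<lambda>A. p \<in> snd (vmeet (f A) (g A) i))"
    by eventually_elim (simp add: vmeet_def)
next
  fix i
  assume "fst (vmeet v w i)"
  then have "fst (v i)" "fst (w i)"
    by (simp_all add: vmeet_def)
  from approxD(2)[OF assms(1) this(1)] approxD(2)[OF assms(2) this(2)]
  show "eventually_finite (\<lambda>A. fst (vmeet (f A) (g A) i))"
    by eventually_elim (simp add: vmeet_def)
qed

text \<open>Collapsing could break continuity only if \<open>v\<close> were nonzero on both sides
  while its approximations stayed zero on one. But a nonzero component shows a flag or a single
  non-diagonal pair, which the approximations eventually show too.\<close>

lemma approx_collapse:
  assumes v: "approx v f" "vok \<Omega> v" and f: "\<And>A. vok \<Omega> (f A)"
  shows "approx (collapse \<Omega> v) (\<lambda>A. collapse \<Omega> (f A))"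
proof (cases "\<exists>i. v i = (False, Id_on \<Omega>)")
  case True
  have "Id_on \<Omega> \<subseteq> snd (collapse \<Omega> (f A) i)" for A i
    using vok_collapse[OF f] EqL_D(2) unfolding vok_def by blast
  then have "p \<in> snd (collapse \<Omega> (f A) i)" if "p \<in> Id_on \<Omega>" for p A i
    using that by blast
  then show ?thesis
    using True by (simp add: collapse_def[of \<Omega> v] approx_def vzero_def)
next
  case False
  have ne: "eventually_finite (\<lambda>A. f A i \<noteq> (False, Id_on \<Omega>))" for i
  proof (cases "fst (v i)")
    case True
    from approxD(2)[OF v(1) True] show ?thesis
      by eventually_elim auto
  next
    case nf: False
    have "snd (v i) \<noteq> Id_on \<Omega>"
      using nf False by (metis prod.collapse)
    moreover have "Id_on \<Omega> \<subseteq> snd (v i)"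
      using v(2) EqL_D(2) unfolding vok_def by blast
    ultimately obtain p where p: "p \<in> snd (v i)" "p \<notin> Id_on \<Omega>"
      by blast
    from approxD(1)[OF v(1) p(1)] show ?thesis
      by eventually_elim (use p(2) in auto)
  qed
  have "eventually_finite (\<lambda>A. collapse \<Omega> (f A) = f A)"
    using ne[of True] ne[of False]
    by eventually_elim (simp add: collapse_def, metis (full_types))
  note ev = this
  show ?thesis
    unfolding approx_def
  proof (intro allI conjI ballI impI)
    fix i p
    assume "p \<in> snd (collapse \<Omega> v i)"
    then have "p \<in> snd (v i)"
      using False by (simp add: collapse_def)
    from approxD(1)[OF v(1) this] ev show "eventually_finite (\<lambda>A. p \<in> snd (collapse \<Omega> (f A) i))"
      by eventually_elim simp
  next
    fix i
    assume "fst (collapse \<Omega> v i)"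
    then have "fst (v i)"
      using False by (simp add: collapse_def)
    from approxD(2)[OF v(1) this] ev show "eventually_finite (\<lambda>A. fst (collapse \<Omega> (f A) i))"
      by eventually_elim simp
  qed
qed

lemma approx_up: "approx (up \<Omega> t) (\<lambda>A. up \<Omega> (trunc \<Omega> A t))"
proof (induction t)
  case (gen i a)
  show ?case
    unfolding up_gen trunc_gen nrm_id[OF res_EqL]
    by (intro approx_collapse approx_vgen vok_vgen nrm_EqL res_EqL)
next
  case (Join s t)
  then show ?case
    unfolding up.simps trunc.simps by (rule approx_vjoin)
next
  case (Meet s t)
  then show ?case
    unfolding up.simps trunc.simps by (intro approx_collapse approx_vmeet vok_vmeet vok_up)
qed

text \<open>Pass to the limit in the bounds: if \<open>s\<close> had no bound on side
  \<open>i\<close>, neither would some finite truncation, and every pair of the least bound of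
  \<open>s\<close> already occurs in the bound of some finite truncation.\<close>

lemma le_gen_if_trunc_le:
  assumes "\<And>A. finite A \<Longrightarrow> le \<Omega> (trunc \<Omega> A s) (gen i a)"
  shows "le \<Omega> s (gen i a)"
proof -
  have fin: "\<not> fst (up \<Omega> (trunc \<Omega> A s) i)" "snd (up \<Omega> (trunc \<Omega> A s) i) \<subseteq> nrm \<Omega> a" if "finite A" for A
    using up_mono[OF assms[OF that]] unfolding vle_def by (metis up_gen_component fst_conv snd_conv)+
  have nf: "\<not> fst (up \<Omega> s i)"
    using fin(1) approxD(2)[OF approx_up] eventually_finite_happens by blast
  have "snd (up \<Omega> s i) \<subseteq> nrm \<Omega> a"
  proof
    fix p
    assume "p \<in> snd (up \<Omega> s i)"
    from eventually_finite_happens[OF approxD(1)[OF approx_up this]]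
    show "p \<in> nrm \<Omega> a"
      using fin(2) by blast
  qed
  moreover have "snd (up \<Omega> s i) \<in> EqL \<Omega>"
    using vok_up unfolding vok_def by blast
  ultimately have "le \<Omega> (gen i (snd (up \<Omega> s i))) (gen i a)"
    by (simp add: le.gen_mono)
  then show ?thesis
    using le_gen_up[OF nf] le.transitive by blast
qed

subsection \<open>Density of the finite terms\<close>

lemma le_if_trunc_le:
  assumes "\<And>A. finite A \<Longrightarrow> le \<Omega> (trunc \<Omega> A s) t"
  shows "le \<Omega> s t"
  using assms
proof (induction "size s + size t" arbitrary: s t rule: less_induct)
  case less
  show ?case
  proof (cases t)
    case (Gen g)
    then have t: "t = gen (side g) (val g)"
      by (simp add: Gen_eq)
    have "le \<Omega> s (gen (side g) (val g))"
    proof (rule le_gen_if_trunc_le)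
      show "le \<Omega> (trunc \<Omega> A s) (gen (side g) (val g))" if "finite A" for A
        using less.prems[OF that] unfolding t .
    qed
    then show ?thesis
      unfolding t .
  next
    case (Meet t0 t1)
    have "le \<Omega> (trunc \<Omega> A s) t0" "le \<Omega> (trunc \<Omega> A s) t1" if "finite A" for A
      using less.prems[OF that] le.transitive[OF _ le.meet1] le.transitive[OF _ le.meet2]
      unfolding Meet by blast+
    then have "le \<Omega> s t0" "le \<Omega> s t1"
      using less.hyps[of s t0] less.hyps[of s t1] Meet by simp_all
    then show ?thesis
      using Meet by (simp add: le.meet_greatest)
  next
    case t: (Join t0 t1)
    show ?thesis
    proof (cases s)
      case (Gen g)
      let ?i = "side g"
      \<comment> \<open>A truncated generator is still a generator, hence below the largest
        generator of its side under \<open>t\<close>.\<close>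
      have "le \<Omega> (trunc \<Omega> A s) (gen ?i (low \<Omega> ?i t))" if "finite A" for A
        using less.prems[OF that] Gen by (simp add: gen_le_low)
      then have "le \<Omega> s (gen ?i (low \<Omega> ?i t))"
        by (rule le_gen_if_trunc_le)
      then show ?thesis
        using low_le by (rule le.transitive)
    next
      case (Join s0 s1)
      have "le \<Omega> (trunc \<Omega> A s0) t" "le \<Omega> (trunc \<Omega> A s1) t" if "finite A" for A
        using less.prems[OF that] le.transitive[OF le.join1] le.transitive[OF le.join2]
        unfolding Join trunc.simps by blast+
      then have "le \<Omega> s0 t" "le \<Omega> s1 t"
        using less.hyps[of s0 t] less.hyps[of s1 t] Join by simp_all
      then show ?thesis
        using Join by (simp add: le.join_least)
    next
      case s: (Meet s0 s1)
      show ?thesis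
      proof (rule ccontr)
        assume n: "\<not> le \<Omega> s t"
        have ns: "\<not> le \<Omega> s0 t" "\<not> le \<Omega> s1 t" "\<not> le \<Omega> s t0" "\<not> le \<Omega> s t1"
          using n le.transitive[OF le.meet1, of \<Omega> s0 t s1] le.transitive[OF le.meet2, of \<Omega> s1 t s0]
            le.transitive[OF _ le.join1, of \<Omega> s t0 t1] le.transitive[OF _ le.join2, of \<Omega> s t1 t0]
          unfolding s t by blast+
        have ng: "\<not> le \<Omega> s (gen i (low \<Omega> i t))" for i
          using n low_le le.transitive by blast
        obtain A0 where A0: "finite A0" "\<not> le \<Omega> (trunc \<Omega> A0 s0) t"
          using less.hyps[of s0 t] ns(1) s by auto
        obtain A1 where A1: "finite A1" "\<not> le \<Omega> (trunc \<Omega> A1 s1) t"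
          using less.hyps[of s1 t] ns(2) s by auto
        obtain A2 where A2: "finite A2" "\<not> le \<Omega> (trunc \<Omega> A2 s) t0"
          using less.hyps[of s t0] ns(3) t by auto
        obtain A3 where A3: "finite A3" "\<not> le \<Omega> (trunc \<Omega> A3 s) t1"
          using less.hyps[of s t1] ns(4) t by auto
        \<comment> \<open>A generator between \<open>trunc \<Omega> A s\<close> and \<open>t\<close>
          may depend on \<open>A\<close>, but it lies below \<open>low \<Omega> i t\<close>. It
          suffices to exclude these two fixed generators.\<close>
        have "\<exists>A. finite A \<and> \<not> le \<Omega> (trunc \<Omega> A s) (gen i (low \<Omega> i t))" for i
          using ng[of i] le_gen_if_trunc_le[of \<Omega> s i "low \<Omega> i t"] by blast
        then obtain B where B: "\<And>i. finite (B i)" "\<And>i. \<not> le \<Omega> (trunc \<Omega> (B i) s) (gen i (low \<Omega> i t))"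
          by metis
        \<comment> \<open>Enlarging the set only increases the truncation of \<open>s\<close>, so
          the union refutes all alternatives of Whitman's condition at once.\<close>
        define A where "A = A0 \<union> A1 \<union> A2 \<union> A3 \<union> B True \<union> B False"
        have A: "\<not> le \<Omega> (trunc \<Omega> A x) y" if "\<not> le \<Omega> (trunc \<Omega> C x) y" "C \<subseteq> A" for C x y
          using that le.transitive[OF trunc_mono] by blast
        have "B i \<subseteq> A" for i
          by (cases i) (auto simp: A_def)
        then have gA: "\<not> le \<Omega> (trunc \<Omega> A s) (gen i (low \<Omega> i t))" for i
          using A[OF B(2)] by blast
        have nA: "\<not> le \<Omega> (trunc \<Omega> A s0) t" "\<not> le \<Omega> (trunc \<Omega> A s1) t"
          "\<not> le \<Omega> (trunc \<Omega> A s) t0" "\<not> le \<Omega> (trunc \<Omega> A s) t1"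
          using A[OF A0(2)] A[OF A1(2)] A[OF A2(2)] A[OF A3(2)] by (auto simp: A_def)
        have "finite A"
          using A0 A1 A2 A3 B by (simp add: A_def)
        then have "le \<Omega> (Meet (trunc \<Omega> A s0) (trunc \<Omega> A s1)) (Join t0 t1)"
          using less.prems s t by simp
        moreover have "\<not> (le \<Omega> (trunc \<Omega> A s) (gen i a) \<and> le \<Omega> (gen i a) t)" for i a
          using gA[of i] le.transitive gen_le_low by blast
        ultimately show False
          using whitman[of \<Omega> "trunc \<Omega> A s0" "trunc \<Omega> A s1" t0 t1] nA s t by simp
      qed
    qed
  qed
qed

subsection \<open>Gadget graphs\<close>

text \<open>\<open>Child e a b j\<close> is the \<open>j\<close>-th edge (\<open>j < 4\<close>) of the path with colours \<open>a, b, a, b\<close> that joins the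
  ends of \<open>e\<close>. A vertex other than the centre \<open>None\<close> is named by the edge that created it, of which it
  is the target; so the last edge of a path creates none.\<close>

datatype 'c edge = Root 'c | Child "'c edge" 'c 'c nat

fun tgt :: "'c edge \<Rightarrow> 'c edge option" where
  "tgt (Root c) = Some (Root c)"
| "tgt (Child e a b j) = (if j < 3 then Some (Child e a b j) else tgt e)"

fun src :: "'c edge \<Rightarrow> 'c edge option" where
  "src (Root c) = None"
| "src (Child e a b j) = (if j = 0 then src e else Some (Child e a b (j - 1)))"

fun color :: "'c edge \<Rightarrow> 'c" where
  "color (Root c) = c"
| "color (Child e a b j) = (if even j then a else b)"

fun level :: "'c edge \<Rightarrow> nat" where
  "level (Root c) = 1"
| "level (Child e a b j) = Suc (level e)"

definition vlevel :: "'c edge option \<Rightarrow> nat" where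
  "vlevel v = (case v of None \<Rightarrow> 0 | Some e \<Rightarrow> level e)"

lemma vlevel_simps [simp]: "vlevel None = 0" "vlevel (Some e) = level e"
  by (simp_all add: vlevel_def)

lemma vlevel_src: "vlevel (src e) \<le> level e"
  by (induction e) auto

lemma vlevel_tgt: "vlevel (tgt e) \<le> level e"
  by (induction e) auto

lemma level_neq_0 [simp]: "level e \<noteq> 0"
  by (induction e) auto

lemma tgt_neq_Child: "tgt e \<noteq> Some (Child e a b j)"
  using vlevel_tgt[of e] by fastforce

text \<open>A normal form for being connected by edges with colours in \<open>S\<close>: walk towards the ends of the
  parent edge as far as possible, and otherwise to the first vertex reachable on the path.\<close>

function nf :: "'c set \<Rightarrow> 'c edge option \<Rightarrow> 'c edge option" where
  "nf S None = None"
| "nf S (Some (Root c)) = (if c \<in> S then None else Some (Root c))"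
| "nf S (Some (Child e a b j)) =
    (if j = 0 then if a \<in> S then nf S (src e) else Some (Child e a b 0)
     else if j = 1 then
       if b \<in> S then if a \<in> S then nf S (src e) else Some (Child e a b 0) else Some (Child e a b 1)
     else if b \<in> S then nf S (tgt e) else if a \<in> S then Some (Child e a b 1) else Some (Child e a b j))"
  by pat_completeness auto
termination
  by (relation "measure (vlevel \<circ> snd)")
    (auto simp: le_imp_less_Suc vlevel_src vlevel_tgt)

lemma vlevel_nf: "vlevel (nf S v) \<le> vlevel v"
proof (induction S v rule: nf.induct)
  case (3 S e a b j)
  then show ?case
    using vlevel_src[of e] vlevel_tgt[of e]
    by (auto intro: le_SucI[OF le_trans])
qed auto

lemma nf_src_less: "vlevel (nf S (src e)) < Suc (level e)"
  by (meson le_imp_less_Suc le_trans vlevel_nf vlevel_src)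

lemma nf_tgt_less: "vlevel (nf S (tgt e)) < Suc (level e)"
  by (meson le_imp_less_Suc le_trans vlevel_nf vlevel_tgt)

lemma nf_empty:
  fixes v :: "'c edge option"
  shows "v = None \<or> (\<exists>e. v = Some e \<and> tgt e = Some e) \<Longrightarrow> nf {} v = v"
  by (cases "({} :: 'c set, v)" rule: nf.cases) (auto split: if_splits)

section \<open>Connectivity by edges whose colours lie in a closed set\<close>

locale gadget_graph =
  fixes K :: "'c set" and cov :: "'c \<Rightarrow> 'c \<Rightarrow> 'c \<Rightarrow> bool"
begin

fun valid :: "'c edge \<Rightarrow> bool" where
  "valid (Root c) = (c \<in> K)"
| "valid (Child e a b j) = (valid e \<and> a \<in> K \<and> b \<in> K \<and> cov (color e) a b \<and> j < 4)"

definition vertices :: "'c edge option set" where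
  "vertices = insert None {Some e | e. valid e \<and> tgt e = Some e}"

definition closed :: "'c set \<Rightarrow> bool" where
  "closed S \<longleftrightarrow> (\<forall>a\<in>S. \<forall>b\<in>S. \<forall>c\<in>K. cov c a b \<longrightarrow> c \<in> S)"

lemma None_vertices [simp]: "None \<in> vertices"
  by (simp add: vertices_def)

lemma Child_vertices:
  "Some (Child e a b j) \<in> vertices \<longleftrightarrow>
    valid e \<and> a \<in> K \<and> b \<in> K \<and> cov (color e) a b \<and> j < 3"
  by (auto simp: vertices_def tgt_neq_Child)

lemma Root_vertices [simp]: "Some (Root c) \<in> vertices \<longleftrightarrow> c \<in> K"
  by (auto simp: vertices_def)

lemma src_vertices: "valid e \<Longrightarrow> src e \<in> vertices"
  by (induction e) (auto simp: Child_vertices)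

lemma tgt_vertices: "valid e \<Longrightarrow> tgt e \<in> vertices"
  by (induction e) (auto simp: Child_vertices)

lemma color_in: "valid e \<Longrightarrow> color e \<in> K"
  by (induction e) auto

lemma closed_Int: "closed S \<Longrightarrow> closed T \<Longrightarrow> closed (S \<inter> T)"
  unfolding closed_def by blast

text \<open>If \<open>S\<close> contains both \<open>a\<close> and \<open>b\<close>, the inner
  vertices of a path are sent to different ends of \<open>e\<close>. Closedness then puts the colour
  of \<open>e\<close> into \<open>S\<close>, and by induction both ends have the same normal
  form.\<close>

lemma nf_edge:
  assumes "closed S" "valid e" "color e \<in> S"
  shows "nf S (src e) = nf S (tgt e)"
  using assms(2,3)
proof (induction e)
  case (Child e a b j)
  have e: "nf S (src e) = nf S (tgt e)" if "a \<in> S" "b \<in> S"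
  proof (rule Child.IH)
    show "valid e"
      using Child.prems by simp
    show "color e \<in> S"
      using Child.prems(1) that assms(1) color_in[of e] unfolding closed_def valid.simps by blast
  qed
  have "j = 0 \<or> j = 1 \<or> j = 2 \<or> j = 3"
    using Child.prems by auto
  then show ?case
    using Child.prems e by (elim disjE) auto
qed simp

text \<open>Together with \<open>nf_edge\<close> this identifies equality of normal forms, for
  closed \<open>S\<close>, with the least equivalence containing the edges coloured in
  \<open>S\<close>.\<close>

lemma nf_connected:
  assumes R: "equiv vertices R"
    and edge: "\<And>e. valid e \<Longrightarrow> color e \<in> S \<Longrightarrow> (src e, tgt e) \<in> R"
    and "v \<in> vertices"
  shows "(v, nf S v) \<in> R"
proof -
  have refl: "(x, x) \<in> R" if "x \<in> vertices" for x
    using R that by (meson equiv_def refl_onD)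
  have sym: "(y, x) \<in> R" if "(x, y) \<in> R" for x y
    using R that by (meson equiv_def symD)
  have trans: "(x, z) \<in> R" if "(x, y) \<in> R" "(y, z) \<in> R" for x y z
    using R that by (meson equiv_def transD)
  show ?thesis
    using \<open>v \<in> vertices\<close>
  proof (induction "vlevel v" arbitrary: v rule: less_induct)
    case less
    show ?case
    proof (cases v)
      case None
      then show ?thesis by (simp add: refl)
    next
      case (Some f)
      show ?thesis
      proof (cases f)
        case (Root c)
        then show ?thesis
          using Some less.prems refl[of v] sym[of None v] edge[of f] by auto
      next
        case (Child e a b j)
        have e: "valid e" "a \<in> K" "b \<in> K" "cov (color e) a b" "j < 3"
          using less.prems Some Child by (simp_all add: Child_vertices)
        have step: "(src (Child e a b i), tgt (Child e a b i)) \<in> R"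
          if "i < 4" "(if even i then a else b) \<in> S" for i
          using that e by (intro edge) auto
        have s0: "(Some (Child e a b 0), src e) \<in> R" if "a \<in> S"
          using step[of 0] that sym by simp
        have s1: "(Some (Child e a b 1), Some (Child e a b 0)) \<in> R" if "b \<in> S"
          using step[of 1] that sym by simp
        have s2: "(Some (Child e a b 2), Some (Child e a b 1)) \<in> R" if "a \<in> S"
          using step[of 2] that sym by (simp add: numeral_2_eq_2)
        have s3: "(Some (Child e a b 2), tgt e) \<in> R" if "b \<in> S"
          using step[of 3] that by simp
        have src: "(src e, nf S (src e)) \<in> R"
          using less.hyps[of "src e"] src_vertices[OF e(1)] vlevel_src[of e] Some Child by simp
        have tgt: "(tgt e, nf S (tgt e)) \<in> R"
          using less.hyps[of "tgt e"] tgt_vertices[OF e(1)] vlevel_tgt[of e] Some Child by simp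
        have r: "(v, v) \<in> R"
          using less.prems by (rule refl)
        consider "j = 0" | "j = 1" | "j = 2"
          using e(5) by linarith
        then show ?thesis
        proof cases
          case 1
          then show ?thesis using Some Child r trans[OF s0 src] by auto
        next
          case 2
          then show ?thesis using Some Child r s1 trans[OF s1 trans[OF s0 src]] by auto
        next
          case 3
          then show ?thesis using Some Child r s2 trans[OF s3 tgt] by auto
        qed
      qed
    qed
  qed
qed

definition ker :: "'c set \<Rightarrow> ('c edge option) rel" where
  "ker S = {(x, y). x \<in> vertices \<and> y \<in> vertices \<and> nf S x = nf S y}"

lemma equiv_ker: "equiv vertices (ker S)"
  by (rule equivI) (auto simp: ker_def refl_on_def sym_def trans_def)

text \<open>Apply \<open>nf_connected\<close> to the equivalence \<open>ker T\<close>, which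
  contains all edges with colours in \<open>S\<close>.\<close>

lemma nf_mono:
  assumes "closed S" "closed T" "S \<subseteq> T" "v \<in> vertices"
  shows "nf S v \<in> vertices" "nf T (nf S v) = nf T v"
proof -
  have "(v, nf S v) \<in> ker T"
    using assms(3,4) nf_edge[OF assms(2)]
    by (intro nf_connected equiv_ker) (auto simp: ker_def src_vertices tgt_vertices)
  then show "nf S v \<in> vertices" "nf T (nf S v) = nf T v"
    by (auto simp: ker_def)
qed

lemma ker_mono: "closed S \<Longrightarrow> closed T \<Longrightarrow> S \<subseteq> T \<Longrightarrow> ker S \<subseteq> ker T"
  by (clarsimp simp: ker_def) (metis nf_mono(2))

lemma nf_Child_cases:
  "(\<exists>i. nf S (Some (Child e a b j)) = Some (Child e a b i)) \<or>
    vlevel (nf S (Some (Child e a b j))) < Suc (level e)"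
  using nf_src_less[of S e] nf_tgt_less[of S e] by auto

text \<open>Colour \<open>a\<close> is the only way from the first inner vertex to the source, and
  leaving the other two requires \<open>b\<close>.\<close>

lemma nf_stuck:
  "(if j = 0 then a \<notin> S else b \<notin> S) \<Longrightarrow> \<exists>i. nf S (Some (Child e a b j)) = Some (Child e a b i)"
  by auto

text \<open>A normal form stays on the path of its vertex or drops strictly below the level of that
  path. A vertex of another path that is no higher cannot reach the level of this one.\<close>

lemma nf_vlevel_cases:
  assumes "v \<in> vertices" "nf S v = Some (Child e a b i)" "vlevel v \<le> Suc (level e)"
  shows "\<exists>j<3. v = Some (Child e a b j)"
proof (cases v)
  case (Some f)
  show ?thesis
  proof (cases f)
    case (Child e' a' b' j')
    then have "j' < 3"
      using assms(1) Some by (simp add: Child_vertices)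
    then show ?thesis
      using assms Some Child nf_Child_cases[of S e' a' b' j']
      by (auto simp del: nf.simps)
  next
    case (Root c)
    then show ?thesis
      using assms Some by (simp split: if_splits)
  qed
qed (use assms in auto)

text \<open>Since \<open>x\<close> is stuck on its path under \<open>S\<close>, the vertex
  \<open>y\<close> lies on the same path. What remains is a check of the inner positions against the
  memberships of \<open>a\<close> and \<open>b\<close> in \<open>S\<close> and \<open>T\<close>; it
  succeeds because the path has four edges.\<close>

lemma nf_Int_inj_Child:
  assumes S: "closed S" and T: "closed T"
    and x: "x \<in> vertices" "nf (S \<inter> T) x = x" and y: "y \<in> vertices" "nf (S \<inter> T) y = y"
    and eq: "nf S x = nf S y" "nf T x = nf T y"
    and xe: "x = Some (Child e a b j)" and le: "vlevel y \<le> vlevel x"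
    and nS: "nf S x = Some (Child e a b i)"
  shows "x = y"
proof -
  have "\<exists>j<3. y = Some (Child e a b j)"
    using nf_vlevel_cases[OF y(1), of S e a b i] nS eq le xe by simp
  then obtain j' where j': "j' < 3" "y = Some (Child e a b j')"
    by blast
  have j: "j < 3"
    using x xe by (simp add: Child_vertices)
  \<comment> \<open>Normal forms of the ends of \<open>e\<close> have smaller level than the path,
    so they never coincide with its inner vertices.\<close>
  have ne: "nf S (src e) \<noteq> Some (Child e a b k)" "nf T (src e) \<noteq> Some (Child e a b k)"
      "nf S (tgt e) \<noteq> Some (Child e a b k)" "nf T (tgt e) \<noteq> Some (Child e a b k)"
      "nf (S \<inter> T) (src e) \<noteq> Some (Child e a b k)" "nf (S \<inter> T) (tgt e) \<noteq> Some (Child e a b k)" for k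
    using nf_src_less[of _ e] nf_tgt_less[of _ e] by (metis level.simps(2) less_irrefl vlevel_simps(2))+
  have "j = 0 \<or> j = 1 \<or> j = 2"
    using j by linarith
  moreover have "j' = 0 \<or> j' = 1 \<or> j' = 2"
    using j' by linarith
  ultimately show ?thesis
    using x(2) y(2) eq unfolding xe j'(2)
    by (elim disjE; cases "a \<in> S"; cases "a \<in> T"; cases "b \<in> S"; cases "b \<in> T")
      (simp_all add: ne ne[THEN not_sym])
qed
text \<open>As \<open>x\<close> is its own normal form for the intersection, the colour leading out
  of it is missing from \<open>S\<close> or from \<open>T\<close>. Under that set \<open>x\<close>
  is stuck, and the two cases are symmetric.\<close>

lemma nf_Int_inj:
  assumes S: "closed S" and T: "closed T"
    and x: "x \<in> vertices" "nf (S \<inter> T) x = x" and y: "y \<in> vertices" "nf (S \<inter> T) y = y"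
    and eq: "nf S x = nf S y" "nf T x = nf T y"
    and le: "vlevel y \<le> vlevel x"
  shows "x = y"
proof (cases x)
  case None
  then show ?thesis
    using le by (cases y) auto
next
  case (Some f)
  show ?thesis
  proof (cases f)
    case (Root c)
    then have c: "c \<notin> S \<or> c \<notin> T"
      using x Some by auto
    show ?thesis
    proof (cases y)
      case (Some g)
      then show ?thesis
        using eq c le Root \<open>x = Some f\<close> by (cases g) (auto split: if_splits)
    qed (use eq c Root Some in auto)
  next
    case (Child e a b j)
    have x': "x = Some (Child e a b j)"
      using Some Child by simp
    have "nf (S \<inter> T) (src e) \<noteq> Some (Child e a b j)" "nf (S \<inter> T) (tgt e) \<noteq> Some (Child e a b j)"
      using nf_src_less[of "S \<inter> T" e] nf_tgt_less[of "S \<inter> T" e] by fastforce+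
    then have "if j = 0 then a \<notin> S \<inter> T else b \<notin> S \<inter> T"
      using x(2) unfolding x' nf.simps by (simp split: if_split_asm)
    then have "(if j = 0 then a \<notin> S else b \<notin> S) \<or> (if j = 0 then a \<notin> T else b \<notin> T)"
      by auto
    then consider i where "nf S x = Some (Child e a b i)" | i where "nf T x = Some (Child e a b i)"
      unfolding x' by (blast dest: nf_stuck)
    then show ?thesis
    proof cases
      case 1
      then show ?thesis
        by (rule nf_Int_inj_Child[OF S T x y eq x' le])
    next
      case 2
      have "nf (T \<inter> S) x = x" "nf (T \<inter> S) y = y"
        using x(2) y(2) by (simp_all add: Int_commute)
      then show ?thesis
        using nf_Int_inj_Child[OF T S x(1) _ y(1) _ eq(2,1) x' le 2] by blast
    qed
  qed
qed

text \<open>Replacing both vertices by their normal forms for \<open>S \<inter> T\<close> changes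
  neither their \<open>S\<close>-class nor their \<open>T\<close>-class. So only reduced vertices
  must be separated, with the one of higher level playing the role of \<open>x\<close> in
  \<open>nf_Int_inj\<close>.\<close>

lemma ker_Int:
  assumes S: "closed S" and T: "closed T"
  shows "ker (S \<inter> T) = ker S \<inter> ker T"
proof
  show "ker (S \<inter> T) \<subseteq> ker S \<inter> ker T"
    by (simp add: ker_mono closed_Int S T)
  note nf = nf_mono[OF closed_Int[OF S T]]
  show "ker S \<inter> ker T \<subseteq> ker (S \<inter> T)"
  proof clarify
    fix x y
    assume *: "(x, y) \<in> ker S" "(x, y) \<in> ker T"
    then have xy: "x \<in> vertices" "y \<in> vertices"
      by (simp_all add: ker_def)
    let ?x = "nf (S \<inter> T) x" and ?y = "nf (S \<inter> T) y"
    have "?x \<in> vertices" "?y \<in> vertices" "nf (S \<inter> T) ?x = ?x" "nf (S \<inter> T) ?y = ?y"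
      "nf S ?x = nf S ?y" "nf T ?x = nf T ?y"
      using * xy nf[OF S] nf[OF T] nf[OF closed_Int[OF S T]] by (auto simp: ker_def)
    then have "?x = ?y"
      using nf_Int_inj[OF S T, of ?x ?y] nf_Int_inj[OF S T, of ?y ?x]
      by (cases "vlevel ?y \<le> vlevel ?x") simp_all
    then show "(x, y) \<in> ker (S \<inter> T)"
      using xy by (simp add: ker_def)
  qed
qed

lemma ker_subset_of_edges:
  assumes "equiv vertices R" "\<And>e. valid e \<Longrightarrow> color e \<in> S \<Longrightarrow> (src e, tgt e) \<in> R"
  shows "ker S \<subseteq> R"
proof clarify
  fix x y
  assume "(x, y) \<in> ker S"
  then have "(x, nf S x) \<in> R" "(y, nf S x) \<in> R"
    using nf_connected[OF assms, where v = x and S = S] nf_connected[OF assms, where v = y and S = S] by (auto simp: ker_def)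
  then show "(x, y) \<in> R"
    using assms(1) by (meson equiv_def symD transD)
qed

lemma ker_join_subset:
  assumes S: "closed S" "S \<subseteq> K" and T: "closed T" "T \<subseteq> K"
    and U: "\<And>c. c \<in> U \<Longrightarrow> c \<in> S \<or> c \<in> T \<or> (\<exists>a\<in>S. \<exists>b\<in>T. cov c a b)"
    and R: "equiv vertices R" "ker S \<subseteq> R" "ker T \<subseteq> R"
  shows "ker U \<subseteq> R"
proof (rule ker_subset_of_edges[OF R(1)])
  fix e
  assume e: "valid e" "color e \<in> U"
  have trans: "(x, z) \<in> R" if "(x, y) \<in> R" "(y, z) \<in> R" for x y z
    using R that by (meson equiv_def transD)
  have edge: "(src f, tgt f) \<in> R" if "valid f" "color f \<in> S \<or> color f \<in> T" for f
    using that nf_edge[OF S(1)] nf_edge[OF T(1)] R src_vertices tgt_vertices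
    by (auto simp: ker_def)
  consider "color e \<in> S \<or> color e \<in> T" | a b where "a \<in> S" "b \<in> T" "cov (color e) a b"
    using U[OF e(2)] by blast
  then show "(src e, tgt e) \<in> R"
  proof cases
    case 2
    have step: "(src (Child e a b i), tgt (Child e a b i)) \<in> R" if "i < 4" for i
      using that e 2 S T by (intro edge) auto
    have "(src e, Some (Child e a b 0)) \<in> R" "(Some (Child e a b 0), Some (Child e a b 1)) \<in> R"
      "(Some (Child e a b 1), Some (Child e a b 2)) \<in> R" "(Some (Child e a b 2), tgt e) \<in> R"
      using step[of 0] step[of 1] step[of 2] step[of 3] by (simp_all add: numeral_2_eq_2)
    then show ?thesis
      by (blast intro: trans)
  qed (use e edge in blast)
qed

lemma nf_K: "v \<in> vertices \<Longrightarrow> nf K v = None"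
proof (induction "vlevel v" arbitrary: v rule: less_induct)
  case less
  show ?case
  proof (cases v)
    case (Some f)
    show ?thesis
    proof (cases f)
      case (Child e a b j)
      then have e: "valid e" "a \<in> K" "b \<in> K"
        using less.prems Some by (simp_all add: Child_vertices)
      have "nf K (src e) = None" "nf K (tgt e) = None"
        using less.hyps src_vertices[OF e(1)] tgt_vertices[OF e(1)] vlevel_src[of e] vlevel_tgt[of e]
          Some Child by (simp_all add: le_imp_less_Suc)
      then show ?thesis
        using Some Child e by simp
    qed (use less.prems Some in simp)
  qed simp
qed

lemma nf_vertices_empty: "v \<in> vertices \<Longrightarrow> nf {} v = v"
  by (rule nf_empty) (auto simp: vertices_def)

end

subsection \<open>Cardinalities\<close>

text \<open>An injective pairing and infinitely many tags suffice to code finite trees labelled in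
  \<open>A\<close> by elements of \<open>A\<close>.\<close>

locale pairing =
  fixes A :: "'a set" and pair :: "'a \<Rightarrow> 'a \<Rightarrow> 'a" and num :: "nat \<Rightarrow> 'a"
  assumes pair_in [simp]: "x \<in> A \<Longrightarrow> y \<in> A \<Longrightarrow> pair x y \<in> A"
    and pair_eq [simp]: "x \<in> A \<Longrightarrow> y \<in> A \<Longrightarrow> x' \<in> A \<Longrightarrow> y' \<in> A \<Longrightarrow> pair x y = pair x' y' \<longleftrightarrow> x = x' \<and> y = y'"
    and num_in [simp]: "num n \<in> A"
    and num_eq [simp]: "num m = num n \<longleftrightarrow> m = n"

lemma infinite_Times_lepoll:
  assumes "infinite A"
  shows "A \<times> A \<lesssim> A"
  using card_of_Times_same_infinite[OF assms]
  by (simp add: eqpoll_iff_card_of_ordIso[symmetric] eqpoll_imp_lepoll)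

lemma infinite_pairing:
  assumes "infinite A"
  shows "\<exists>pair num. pairing A pair num"
proof -
  obtain p where p: "inj_on p (A \<times> A)" "p ` (A \<times> A) \<subseteq> A"
    using infinite_Times_lepoll[OF assms] by (auto simp: lepoll_def)
  obtain num :: "nat \<Rightarrow> 'a" where num: "inj num" "range num \<subseteq> A"
    using infinite_countable_subset[OF assms] by blast
  have "pairing A (\<lambda>x y. p (x, y)) num"
    using p num by unfold_locales (auto simp: inj_on_eq_iff[OF p(1)] inj_eq)
  then show ?thesis
    by blast
qed

context pairing
begin

fun encode_list :: "'a list \<Rightarrow> 'a" where
  "encode_list [] = pair (num 0) (num 0)"
| "encode_list (x # xs) = pair (num 1) (pair x (encode_list xs))"

lemma encode_list_in [simp]: "set xs \<subseteq> A \<Longrightarrow> encode_list xs \<in> A"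
  by (induction xs) auto

lemma encode_list_eq:
  "set xs \<subseteq> A \<Longrightarrow> set ys \<subseteq> A \<Longrightarrow> encode_list xs = encode_list ys \<Longrightarrow> xs = ys"
proof (induction xs arbitrary: ys)
  case Nil
  then show ?case by (cases ys) auto
next
  case (Cons x xs)
  show ?case
    using Cons.prems by (cases ys) (auto intro!: Cons.IH)
qed

fun encode_term :: "('g \<Rightarrow> 'a) \<Rightarrow> 'g lterm \<Rightarrow> 'a" where
  "encode_term f (Gen g) = pair (num 0) (f g)"
| "encode_term f (Join s t) = pair (num 1) (pair (encode_term f s) (encode_term f t))"
| "encode_term f (Meet s t) = pair (num 2) (pair (encode_term f s) (encode_term f t))"

lemma encode_term_in [simp]: "(\<And>g. g \<in> set_lterm t \<Longrightarrow> f g \<in> A) \<Longrightarrow> encode_term f t \<in> A"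
  by (induction t) auto

lemma encode_term_eq:
  assumes f: "inj_on f G" "\<And>g. g \<in> G \<Longrightarrow> f g \<in> A"
  shows "set_lterm s \<subseteq> G \<Longrightarrow> set_lterm t \<subseteq> G \<Longrightarrow> encode_term f s = encode_term f t \<Longrightarrow> s = t"
proof (induction s arbitrary: t)
  case (Gen g)
  then show ?case
    using f by (cases t) (auto simp: inj_on_eq_iff subset_iff)
next
  case (Join s1 s2)
  show ?case
    using Join.prems f by (cases t) (auto simp: subset_iff intro!: Join.IH)
next
  case (Meet s1 s2)
  show ?case
    using Meet.prems f by (cases t) (auto simp: subset_iff intro!: Meet.IH)
qed

fun encode_edge :: "'a edge \<Rightarrow> 'a" where
  "encode_edge (Root c) = pair (num 0) c"
| "encode_edge (Child e a b j) = pair (num (Suc j)) (pair (encode_edge e) (pair a b))"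

lemma encode_edge_in [simp]: "set_edge e \<subseteq> A \<Longrightarrow> encode_edge e \<in> A"
  by (induction e) auto

lemma encode_edge_eq:
  "set_edge e \<subseteq> A \<Longrightarrow> set_edge f \<subseteq> A \<Longrightarrow> encode_edge e = encode_edge f \<Longrightarrow> e = f"
proof (induction e arbitrary: f)
  case (Root c)
  then show ?case by (cases f) auto
next
  case (Child e a b j)
  show ?case
    using Child.prems by (cases f) (auto intro!: Child.IH)
qed

end

lemma lists_lepoll:
  assumes "infinite A"
  shows "lists A \<lesssim> A"
proof -
  obtain pair num where "pairing A pair num"
    using infinite_pairing[OF assms] by blast
  then interpret pairing A pair num .
  have "inj_on encode_list (lists A)" "encode_list ` lists A \<subseteq> A"
    by (auto intro: inj_onI encode_list_eq simp: lists_eq_set)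
  then show ?thesis
    unfolding lepoll_def by blast
qed

lemma finite_subsets_lepoll:
  assumes "infinite A"
  shows "{B. finite B \<and> B \<subseteq> A} \<lesssim> A"
proof -
  have "{B. finite B \<and> B \<subseteq> A} \<subseteq> set ` lists A"
    unfolding lists_eq_set using finite_list by blast
  then have "{B. finite B \<and> B \<subseteq> A} \<lesssim> lists A"
    by (rule subset_image_lepoll)
  then show ?thesis
    using lists_lepoll[OF assms] by (rule lepoll_trans)
qed

lemma lterms_lepoll:
  assumes "infinite A" "G \<lesssim> A"
  shows "{t. set_lterm t \<subseteq> G} \<lesssim> A"
proof -
  obtain pair num where "pairing A pair num"
    using infinite_pairing[OF assms(1)] by blast
  then interpret pairing A pair num .
  obtain f where f: "inj_on f G" "\<And>g. g \<in> G \<Longrightarrow> f g \<in> A"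
    using assms(2) unfolding lepoll_def by blast
  have "inj_on (encode_term f) {t. set_lterm t \<subseteq> G}"
    using encode_term_eq[OF f] by (intro inj_onI) blast
  moreover have "encode_term f ` {t. set_lterm t \<subseteq> G} \<subseteq> A"
    using f(2) by (auto intro!: encode_term_in)
  ultimately show ?thesis
    unfolding lepoll_def by blast
qed

lemma edges_lepoll:
  assumes "infinite A"
  shows "{e. set_edge e \<subseteq> A} \<lesssim> A"
proof -
  obtain pair num where "pairing A pair num"
    using infinite_pairing[OF assms] by blast
  then interpret pairing A pair num .
  have "inj_on encode_edge {e. set_edge e \<subseteq> A}" "encode_edge ` {e. set_edge e \<subseteq> A} \<subseteq> A"
    by (auto intro: inj_onI encode_edge_eq)
  then show ?thesis
    unfolding lepoll_def by blast
qed

lemma (in gadget_graph) vertices_eqpoll: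
  assumes "infinite K"
  shows "K \<approx> vertices"
proof (rule lepoll_antisym)
  show "K \<lesssim> vertices"
    unfolding lepoll_def by (rule exI[of _ "\<lambda>c. Some (Root c)"]) (auto simp: inj_on_def)
  let ?E = "Some ` {e. set_edge e \<subseteq> K}"
  have E: "e \<in> {e. set_edge e \<subseteq> K}" if "valid e" for e
    using that by (induction e) auto
  have sub: "vertices \<subseteq> insert None ?E"
    unfolding vertices_def using E by blast
  have inf: "infinite ?E"
  proof
    assume "finite ?E"
    moreover have "(\<lambda>c. Some (Root c)) ` K \<subseteq> ?E"
      by auto
    ultimately have "finite ((\<lambda>c. Some (Root c)) ` K)"
      by (rule rev_finite_subset)
    then show False
      using assms by (simp add: finite_image_iff inj_on_def)
  qed
  have "vertices \<lesssim> ?E"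
    by (rule lepoll_trans[OF subset_imp_lepoll[OF sub] infinite_insert_lepoll[OF inf]])
  also have "?E \<lesssim> K"
    using lepoll_trans[OF image_lepoll edges_lepoll[OF assms]] .
  finally show "vertices \<lesssim> K" .
qed

section \<open>Transport of the relations on the vertices to a set of the same size\<close>

locale labelled_gadget_graph = gadget_graph K cov
  for K :: "'c set" and cov +
  fixes X :: "'x set" and vertex :: "'x \<Rightarrow> 'c edge option"
  assumes vertex: "bij_betw vertex X vertices"
begin

definition eqrel :: "'c set \<Rightarrow> 'x rel" where
  "eqrel S = {(p, q). p \<in> X \<and> q \<in> X \<and> (vertex p, vertex q) \<in> ker S}"

lemma vertex_in: "p \<in> X \<Longrightarrow> vertex p \<in> vertices"
  using vertex bij_betwE by blast

lemma vertex_eq: "p \<in> X \<Longrightarrow> q \<in> X \<Longrightarrow> vertex p = vertex q \<longleftrightarrow> p = q"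
  using vertex unfolding bij_betw_def by (meson inj_on_eq_iff)

lemma vertex_surj: "v \<in> vertices \<Longrightarrow> \<exists>p\<in>X. vertex p = v"
  using vertex unfolding bij_betw_def by (metis imageE)

lemma eqrel_iff: "(p, q) \<in> eqrel S \<longleftrightarrow> p \<in> X \<and> q \<in> X \<and> nf S (vertex p) = nf S (vertex q)"
  by (auto simp: eqrel_def ker_def vertex_in)

lemma eqrel_EqL: "eqrel S \<in> EqL X"
  by (rule EqL_I) (auto simp: eqrel_iff)

lemma eqrel_mono: "closed S \<Longrightarrow> closed T \<Longrightarrow> S \<subseteq> T \<Longrightarrow> eqrel S \<subseteq> eqrel T"
  using ker_mono unfolding eqrel_def by blast

lemma eqrel_Int: "closed S \<Longrightarrow> closed T \<Longrightarrow> eqrel (S \<inter> T) = eqrel S \<inter> eqrel T"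
  unfolding eqrel_def by (auto simp: ker_Int)

lemma eqrel_empty: "eqrel {} = Id_on X"
  by (auto simp: eqrel_iff nf_vertices_empty vertex_in vertex_eq)

lemma eqrel_K: "eqrel K = X \<times> X"
  by (auto simp: eqrel_iff nf_K vertex_in)

text \<open>This is the purpose of the root edges: the vertex \<open>Some (Root c)\<close> is tied
  to the centre exactly when \<open>c\<close> is among the colours, so the relation determines its
  colour set.\<close>

lemma eqrel_subset_imp:
  assumes "eqrel S \<subseteq> eqrel T" "c \<in> S" "c \<in> K"
  shows "c \<in> T"
proof -
  obtain p q where p: "p \<in> X" "vertex p = None" and q: "q \<in> X" "vertex q = Some (Root c)"
    using vertex_surj[of None] vertex_surj[of "Some (Root c)"] assms(3) by auto
  then have "(p, q) \<in> eqrel S"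
    using assms(2) by (simp add: eqrel_iff)
  then have "(p, q) \<in> eqrel T"
    using assms(1) by blast
  then show ?thesis
    using p q by (simp add: eqrel_iff split: if_splits)
qed

text \<open>The join on \<open>X\<close> is carried along \<open>vertex\<close> to an equivalence on
  the vertices. It contains \<open>ker S\<close> and \<open>ker T\<close>, hence by the attached
  paths also every edge with a colour in \<open>U\<close>.\<close>

lemma eqrel_join:
  assumes S: "closed S" "S \<subseteq> K" and T: "closed T" "T \<subseteq> K" and U: "closed U" "S \<subseteq> U" "T \<subseteq> U"
    and cov: "\<And>c. c \<in> U \<Longrightarrow> c \<in> S \<or> c \<in> T \<or> (\<exists>a\<in>S. \<exists>b\<in>T. cov c a b)"
  shows "eqrel U = eq_join (eqrel S) (eqrel T)"
proof
  show "eq_join (eqrel S) (eqrel T) \<subseteq> eqrel U"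
    using S T U by (intro eq_join_least[OF eqrel_EqL] eqrel_mono)
  define J where "J = eq_join (eqrel S) (eqrel T)"
  have J: "J \<in> EqL X"
    unfolding J_def by (intro eq_join_EqL eqrel_EqL)
  define R where "R = {(vertex p, vertex q) | p q. (p, q) \<in> J}"
  have R_iff: "(vertex p, vertex q) \<in> R \<longleftrightarrow> (p, q) \<in> J" if "p \<in> X" "q \<in> X" for p q
  proof
    assume "(vertex p, vertex q) \<in> R"
    then obtain p' q' where pq: "vertex p = vertex p'" "vertex q = vertex q'" "(p', q') \<in> J"
      unfolding R_def by blast
    then have "p' \<in> X" "q' \<in> X"
      using EqL_D(1)[OF J] by blast+
    then show "(p, q) \<in> J"
      using pq that by (simp add: vertex_eq)
  qed (auto simp: R_def)
  have R: "R \<subseteq> vertices \<times> vertices"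
    using EqL_D(1)[OF J] vertex_in unfolding R_def by blast
  have "R \<in> EqL vertices"
  proof (rule EqL_I[OF R])
    show "Id_on vertices \<subseteq> R"
      using vertex_surj EqL_D(2)[OF J] R_iff by (fastforce simp: Id_on_def)
    fix x y z
    assume xy: "(x, y) \<in> R"
    then obtain p q where p: "p \<in> X" "x = vertex p" and q: "q \<in> X" "y = vertex q"
      using R vertex_surj by blast
    show "(y, x) \<in> R"
      using xy EqL_D(3)[OF J] unfolding p(2) q(2) R_iff[OF p(1) q(1)] R_iff[OF q(1) p(1)] by blast
    assume yz: "(y, z) \<in> R"
    then obtain r where r: "r \<in> X" "z = vertex r"
      using R vertex_surj by blast
    show "(x, z) \<in> R"
      using xy yz EqL_D(4)[OF J]
      unfolding p(2) q(2) r(2) R_iff[OF p(1) q(1)] R_iff[OF q(1) r(1)] R_iff[OF p(1) r(1)] by blast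
  qed
  then have equiv: "equiv vertices R"
    by (simp add: EqL_def)
  have sub: "ker C \<subseteq> R" if "eqrel C \<subseteq> J" for C
  proof clarify
    fix x y
    assume xy: "(x, y) \<in> ker C"
    then obtain p q where p: "p \<in> X" "x = vertex p" and q: "q \<in> X" "y = vertex q"
      using vertex_surj unfolding ker_def by blast
    then have "(p, q) \<in> eqrel C"
      using xy by (simp add: eqrel_def)
    then show "(x, y) \<in> R"
      using that p q R_iff by blast
  qed
  have ST: "ker S \<subseteq> R" "ker T \<subseteq> R"
    by (simp_all add: sub J_def eq_join_upper)
  have "ker U \<subseteq> R"
    using cov by (rule ker_join_subset[OF S T _ equiv ST])
  then show "eqrel U \<subseteq> eq_join (eqrel S) (eqrel T)"
    unfolding J_def[symmetric]
  proof clarify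
    fix p q
    assume pq: "(p, q) \<in> eqrel U"
    then have "(vertex p, vertex q) \<in> R"
      using \<open>ker U \<subseteq> R\<close> by (auto simp: eqrel_def)
    then show "(p, q) \<in> J"
      using pq by (simp add: eqrel_def R_iff)
  qed
qed

end

text \<open>A truncated generator is given by its side and the finite relation added to the
  identity, which leaves at most |\<Omega>| generators and as many terms.\<close>

lemma trunc_terms_lepoll:
  fixes \<Omega> :: "'a set"
  assumes "infinite \<Omega>"
  shows "{trunc \<Omega> A t | A t. finite A} \<lesssim> \<Omega>"
proof -
  define F where "F = {B. finite B \<and> B \<subseteq> \<Omega> \<times> \<Omega>}"
  define g :: "bool \<times> 'a rel \<Rightarrow> 'a rel + 'a rel"
    where "g = (\<lambda>(i, r). if i then Inl (Id_on \<Omega> \<union> r) else Inr (Id_on \<Omega> \<union> r))"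
  have inf: "infinite (\<Omega> \<times> \<Omega>)"
    using assms by (auto simp: finite_cartesian_product_iff)
  have "F \<lesssim> \<Omega>"
    unfolding F_def using finite_subsets_lepoll[OF inf] infinite_Times_lepoll[OF assms] by (rule lepoll_trans)
  moreover have "(UNIV :: bool set) \<lesssim> \<Omega>"
    using assms by (intro finite_lepoll_infinite) auto
  ultimately have "(UNIV :: bool set) \<times> F \<lesssim> \<Omega> \<times> \<Omega>"
    by (intro times_lepoll_mono)
  then have "(UNIV :: bool set) \<times> F \<lesssim> \<Omega>"
    using infinite_Times_lepoll[OF assms] by (rule lepoll_trans)
  then have G: "g ` (UNIV \<times> F) \<lesssim> \<Omega>"
    by (rule lepoll_trans[OF image_lepoll])
  have "set_lterm (trunc \<Omega> A t) \<subseteq> g ` (UNIV \<times> F)" if "finite A" for A and t :: "'a eqterm"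
  proof (induction t)
    case (gen i a)
    have "nrm \<Omega> a \<inter> A \<times> A \<in> F"
      using that EqL_D(1)[OF nrm_EqL] by (auto simp: F_def)
    moreover have "(if i then Inl (res \<Omega> A a) else Inr (res \<Omega> A a)) = g (i, nrm \<Omega> a \<inter> A \<times> A)"
      by (simp add: g_def res_def)
    ultimately show ?case
      by (simp add: gen_def)
  qed auto
  then have "{trunc \<Omega> A t | A t. finite A} \<subseteq> {t. set_lterm t \<subseteq> g ` (UNIV \<times> F)}"
    by blast
  then show ?thesis
    using lepoll_trans[OF subset_imp_lepoll lterms_lepoll[OF assms G]] by blast
qed

lemma lepoll_surj:
  assumes "C \<lesssim> X" "C \<noteq> {}"
  shows "\<exists>f. f ` X = C"
proof -
  obtain g where g: "C \<subseteq> g ` X"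
    using assms(1) unfolding lepoll_iff by blast
  obtain c where "c \<in> C"
    using assms(2) by blast
  then have "(\<lambda>x. if g x \<in> C then g x else c) ` X = C"
    using g by auto
  then show ?thesis
    by blast
qed

section \<open>The least and the greatest element of the coproduct\<close>

lemma le_top: "le \<Omega> t (coprod0_top \<Omega>)"
proof (induction t)
  case (gen i a)
  have "le \<Omega> (gen i a) (gen i (\<Omega> \<times> \<Omega>))"
    using EqL_D(1)[OF nrm_EqL[of \<Omega> a]] by (intro le.gen_mono) simp
  moreover have "le \<Omega> (gen i (\<Omega> \<times> \<Omega>)) (coprod0_top \<Omega>)"
    by (cases i) (simp_all add: coprod0_top_def gen_def)
  ultimately show ?case
    by (rule le.transitive)
next
  case (Join s t)
  show ?case by (rule le.join_least[OF Join.IH])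
next
  case (Meet s t)
  show ?case by (rule le.transitive[OF le.meet1 Meet.IH(1)])
qed

lemma zero_le: "le \<Omega> (coprod0_zero \<Omega>) t"
proof -
  have "coprod0_zero \<Omega> = gen True (Id_on \<Omega>)"
    by (simp add: coprod0_zero_def gen_def)
  moreover have "le \<Omega> (gen True (Id_on \<Omega>)) (gen True (low \<Omega> True t))"
    using EqL_D(2)[OF low_EqL[of \<Omega> True t]] by (intro le.gen_mono) simp
  ultimately show ?thesis
    using low_le le.transitive by metis
qed

lemma not_top_le_zero:
  assumes "infinite \<Omega>"
  shows "\<not> le \<Omega> (coprod0_top \<Omega>) (coprod0_zero \<Omega>)"
proof
  assume "le \<Omega> (coprod0_top \<Omega>) (coprod0_zero \<Omega>)"
  from low_mono[OF this, of True] have "\<Omega> \<times> \<Omega> \<subseteq> Id_on \<Omega>"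
    using eq_join_upper(1)[of "\<Omega> \<times> \<Omega>" "Id_on \<Omega>"] by (simp add: coprod0_top_def coprod0_zero_def)
  moreover obtain x where "x \<in> \<Omega>"
    using assms by fastforce
  moreover obtain y where "y \<in> \<Omega> - {x}"
    using assms by (metis finite.emptyI infinite_remove equals0I)
  ultimately show False
    by blast
qed

subsection \<open>The embedding\<close>

theorem theorem6p3:
  fixes \<Omega> :: "'a set"
  assumes "infinite \<Omega>"
  shows "\<exists>F. coprod0_embedding \<Omega> F"
proof -
  let ?zero = "coprod0_zero \<Omega>"
  \<comment> \<open>Terms below zero are not colours: zero must have an empty colour set in order to
    go to the identity relation.\<close>
  define C where "C = {t. (\<exists>A s. finite A \<and> t = trunc \<Omega> A s) \<and> \<not> le \<Omega> t ?zero}"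
  have "C \<subseteq> {trunc \<Omega> A t | A t. finite A}"
    unfolding C_def by blast
  then have "C \<lesssim> \<Omega>"
    using trunc_terms_lepoll[OF assms] lepoll_trans subset_imp_lepoll by blast
  \<comment> \<open>If every finite truncation of the top were below zero, density would put the top
    itself below zero.\<close>
  moreover have "C \<noteq> {}"
    using le_if_trunc_le[of \<Omega> "coprod0_top \<Omega>" ?zero] not_top_le_zero[OF assms] unfolding C_def by blast
  \<comment> \<open>The elements of \<Omega> themselves serve as colours, so the graph has exactly
    |\<Omega>| vertices. Repetitions in \<kappa> do no harm, and a surjection spares an exact count
    of \<open>C\<close>.\<close>
  ultimately obtain \<kappa> where \<kappa>: "\<kappa> ` \<Omega> = C"
    using lepoll_surj by blast
  define cov where "cov c a b \<longleftrightarrow> le \<Omega> (\<kappa> c) (Join (\<kappa> a) (\<kappa> b))" for c a b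
  obtain vertex where "bij_betw vertex \<Omega> (gadget_graph.vertices \<Omega> cov)"
    using gadget_graph.vertices_eqpoll[OF assms, of cov] unfolding eqpoll_def by blast
  then interpret labelled_gadget_graph \<Omega> cov \<Omega> vertex
    by unfold_locales
  define S where "S t = {k \<in> \<Omega>. le \<Omega> (\<kappa> k) t}" for t
  have S_sub: "S t \<subseteq> \<Omega>" for t
    by (auto simp: S_def)
  have S_closed: "closed (S t)" for t
    unfolding closed_def
  proof (intro ballI impI)
    fix a b c
    assume "a \<in> S t" "b \<in> S t" "c \<in> \<Omega>" "cov c a b"
    then show "c \<in> S t"
      using le.transitive[of \<Omega> "\<kappa> c" "Join (\<kappa> a) (\<kappa> b)" t] by (simp add: S_def cov_def le.join_least)
  qed
  have S_mono: "S s \<subseteq> S t" if "le \<Omega> s t" for s t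
    using that le.transitive unfolding S_def by blast
  have C_col: "\<exists>k\<in>\<Omega>. \<kappa> k = t" if "t \<in> C" for t
    using that \<kappa> by (metis imageE)
  have le_S: "le \<Omega> s t" if "S s \<subseteq> S t" for s t
  proof (rule le_if_trunc_le)
    fix A :: "'a set"
    assume "finite A"
    show "le \<Omega> (trunc \<Omega> A s) t"
    proof (cases "le \<Omega> (trunc \<Omega> A s) ?zero")
      case True
      then show ?thesis
        using zero_le by (rule le.transitive)
    next
      case False
      then obtain k where "k \<in> \<Omega>" "\<kappa> k = trunc \<Omega> A s"
        using C_col[of "trunc \<Omega> A s"] \<open>finite A\<close> unfolding C_def by blast
      then show ?thesis
        using that trunc_le[of \<Omega> A s] unfolding S_def by force
    qed
  qed
  have cov_S: "c \<in> S s \<or> c \<in> S t \<or> (\<exists>a\<in>S s. \<exists>b\<in>S t. cov c a b)" if c: "c \<in> S (Join s t)" for c s t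
  proof -
    have "\<kappa> c \<in> C"
      using c \<kappa> unfolding S_def by blast
    then obtain A u where u: "finite A" "\<kappa> c = trunc \<Omega> A u"
      unfolding C_def by blast
    \<comment> \<open>Compactness of the finite term \<open>\<kappa> c\<close> replaces
      \<open>s\<close> and \<open>t\<close> by finite terms below them, which are colours unless
      they are zero.\<close>
    obtain B where B: "finite B" "le \<Omega> (\<kappa> c) (Join (trunc \<Omega> B s) (trunc \<Omega> B t))"
      using trunc_compact[of \<Omega> A u "Join s t"] c u unfolding S_def by auto
    \<comment> \<open>If one truncation is zero, there is no colour for it, but then
      \<open>\<kappa> c\<close> already lies below the other argument.\<close>
    consider "le \<Omega> (trunc \<Omega> B s) ?zero" | "le \<Omega> (trunc \<Omega> B t) ?zero"
      | "trunc \<Omega> B s \<in> C" "trunc \<Omega> B t \<in> C"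
      unfolding C_def using B(1) by blast
    then show ?thesis
    proof cases
      case 1
      have "le \<Omega> (Join (trunc \<Omega> B s) (trunc \<Omega> B t)) t"
        using le.transitive[OF 1 zero_le] trunc_le by (intro le.join_least)
      then show ?thesis
        using le.transitive[OF B(2)] c by (simp add: S_def)
    next
      case 2
      have "le \<Omega> (Join (trunc \<Omega> B s) (trunc \<Omega> B t)) s"
        using le.transitive[OF 2 zero_le] trunc_le by (intro le.join_least)
      then show ?thesis
        using le.transitive[OF B(2)] c by (simp add: S_def)
    next
      case 3
      obtain a b where "a \<in> \<Omega>" "\<kappa> a = trunc \<Omega> B s" "b \<in> \<Omega>" "\<kappa> b = trunc \<Omega> B t"
        using C_col[OF 3(1)] C_col[OF 3(2)] by blast
      then have "a \<in> S s" "b \<in> S t" "cov c a b"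
        using B(2) trunc_le by (simp_all add: S_def cov_def)
      then show ?thesis
        by blast
    qed
  qed
  have "coprod0_embedding \<Omega> (\<lambda>t. eqrel (S t))"
    unfolding coprod0_embedding_def
  proof (intro conjI allI impI)
    show "eqrel (S t) \<in> EqL \<Omega>" for t
      by (rule eqrel_EqL)
    show "eqrel (S s) = eqrel (S t)" if "wf_term \<Omega> s" "wf_term \<Omega> t" "coprod0_eq \<Omega> s t" for s t
      using le_iff_of_coprod0_eq[OF that] S_mono by (metis subset_antisym)
    show "eqrel (S (Join s t)) = eq_join (eqrel (S s)) (eqrel (S t))" for s t
      by (intro eqrel_join S_closed S_sub S_mono le.join1 le.join2 cov_S)
    have "S (Meet s t) = S s \<inter> S t" for s t
    proof
      show "S (Meet s t) \<subseteq> S s \<inter> S t"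
        by (simp add: S_mono)
    qed (auto simp: S_def le.meet_greatest)
    then show "eqrel (S (Meet s t)) = eq_meet (eqrel (S s)) (eqrel (S t))" for s t
      by (simp add: eqrel_Int S_closed eq_meet_def)
    have "S ?zero = {}"
      using \<kappa> unfolding S_def C_def by blast
    then show "eqrel (S ?zero) = Id_on \<Omega>"
      by (simp add: eqrel_empty)
    have "S (coprod0_top \<Omega>) = \<Omega>"
      by (simp add: S_def le_top)
    then show "eqrel (S (coprod0_top \<Omega>)) = \<Omega> \<times> \<Omega>"
      by (simp add: eqrel_K)
    show "coprod0_eq \<Omega> s t" if "wf_term \<Omega> s" "wf_term \<Omega> t" "eqrel (S s) = eqrel (S t)" for s t
    proof (rule coprod0_eq_of_le[OF that(1,2)])
      have "S s \<subseteq> S t" "S t \<subseteq> S s"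
        using eqrel_subset_imp[of "S s" "S t"] eqrel_subset_imp[of "S t" "S s"] that(3) S_sub by blast+
      then show "le \<Omega> s t" "le \<Omega> t s"
        using le_S by blast+
    qed
  qed
  then show ?thesis
    by blast
qed

end
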